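(* Let $G=C_n$ be the cycle graph on $n$ vertices with $n\ge 6$, and let $J_G$ be its binomial edge ideal. Then the $\mathrm{v}$-number of $J_G$ is $\mathrm{v}(J_G)=\left\lceil\frac{2n}{3}\right\rceil$.
   Context: For a finite simple graph $G$ on $\{1,\ldots,n\}$ and an arbitrary field $\mathbb{K}$, let $S=\mathbb{K}[x_1,\ldots,x_n,y_1,\ldots,y_n]$ (standard graded, with degree-$d$ component $S_d$); the binomial edge ideal is $J_G=\langle x_iy_j-x_jy_i : \{i,j\}\in E(G)\rangle$. For a proper nonzero homogeneous ideal $I\subseteq S$ and $\mathfrak{p}\in\mathrm{Ass}(I)$, the local $\mathrm{v}$-number is $\mathrm{v}_{\mathfrak{p}}(I)=\min\{d : \exists f\in S_d \text{ with } I:f=\mathfrak{p}\}$, and the $\mathrm{v}$-number is $\mathrm{v}(I)=\min\{\mathrm{v}_{\mathfrak{p}}(I) : \mathfrak{p}\in\mathrm{Ass}(I)\}$. *)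

theory Defs
  imports Complex_Main "HOL-Library.Poly_Mapping" "HOL-Algebra.Ideal"
begin

datatype var = X nat | Y nat

text \<open>A polynomial is a finitely supported map from monomials to coefficients, and a monomial is a
  finitely supported exponent vector. The library's product on \<open>poly_mapping\<close> is convolution, so
  on this type it is multiplication of polynomials.\<close>

type_synonym 'k poly = "(var \<Rightarrow>\<^sub>0 nat) \<Rightarrow>\<^sub>0 'k"

definition indet :: "var \<Rightarrow> 'k::field poly" where
  "indet v = Poly_Mapping.single (Poly_Mapping.single v 1) 1"

definition vars_upto :: "nat \<Rightarrow> var set" where
  "vars_upto n = X ` {1..n} \<union> Y ` {1..n}"

text \<open>The type \<open>'k poly\<close> has infinitely many variables; the carrier cuts it down to
  \<open>K[x\<^sub>1,\<dots>,x\<^sub>n,y\<^sub>1,\<dots>,y\<^sub>n]\<close>, where \<open>K\<close> is all of the field type \<open>'k\<close>.\<close>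

definition poly_ring :: "nat \<Rightarrow> 'k::field poly ring" where
  "poly_ring n =
     \<lparr>carrier = {f. \<forall>m \<in> Poly_Mapping.keys f. Poly_Mapping.keys m \<subseteq> vars_upto n},
      mult = (*), one = 1, zero = 0, add = (+)\<rparr>"

definition mon_degree :: "(var \<Rightarrow>\<^sub>0 nat) \<Rightarrow> nat" where
  "mon_degree m = (\<Sum>v \<in> Poly_Mapping.keys m. Poly_Mapping.lookup m v)"

definition graded_part :: "nat \<Rightarrow> nat \<Rightarrow> 'k::field poly set" where
  "graded_part n d =
     {f \<in> carrier (poly_ring n). \<forall>m \<in> Poly_Mapping.keys f. mon_degree m = d}"

definition colon :: "nat \<Rightarrow> 'k::field poly set \<Rightarrow> 'k poly \<Rightarrow> 'k poly set" where
  "colon n I f = {g \<in> carrier (poly_ring n). g \<otimes>\<^bsub>poly_ring n\<^esub> f \<in> I}"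

text \<open>\<open>Ass(I)\<close> is the set of associated primes of the module \<open>S/I\<close>: the annihilator of the class
  of \<open>f\<close> in \<open>S/I\<close> is \<open>I : f\<close>.\<close>

definition Ass :: "nat \<Rightarrow> 'k::field poly set \<Rightarrow> 'k poly set set" where
  "Ass n I = {P. primeideal P (poly_ring n) \<and> (\<exists>f \<in> carrier (poly_ring n). colon n I f = P)}"

text \<open>The two minima below are over nonempty sets when \<open>I\<close> is a proper homogeneous ideal and
  \<open>P \<in> Ass(I)\<close>; outside that range the values carry no meaning. On the naturals \<open>INF\<close> over a
  nonempty set is its minimum.\<close>

definition local_v_number :: "nat \<Rightarrow> 'k::field poly set \<Rightarrow> 'k poly set \<Rightarrow> nat" where
  "local_v_number n I P = (LEAST d. \<exists>f \<in> graded_part n d. colon n I f = P)"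

definition v_number :: "nat \<Rightarrow> 'k::field poly set \<Rightarrow> nat" where
  "v_number n I = (INF P \<in> Ass n I. local_v_number n I P)"

text \<open>A simple graph on \<open>{1..n}\<close> is given by its set of edges, each a two-element subset of
  \<open>{1..n}\<close>. Interchanging \<open>i\<close> and \<open>j\<close> only changes the sign of a generator.\<close>

definition binomial_edge_ideal :: "nat \<Rightarrow> nat set set \<Rightarrow> 'k::field poly set" where
  "binomial_edge_ideal n E =
     Idl\<^bsub>poly_ring n\<^esub> {indet (X i) * indet (Y j) - indet (X j) * indet (Y i) | i j. {i, j} \<in> E}"

definition cycle_graph :: "nat \<Rightarrow> nat set set" where
  "cycle_graph n = {{i, i + 1} | i. 1 \<le> i \<and> i < n} \<union> {{n, 1}}"

lemma cycle_graph_simple: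
  assumes "n \<ge> 3" "e \<in> cycle_graph n"
  shows "e \<subseteq> {1..n} \<and> card e = 2"
  using assms by (auto simp: cycle_graph_def)

lemma cring_poly_ring: "cring (poly_ring n :: 'k::field poly ring)"
proof -
  let ?C = "carrier (poly_ring n :: 'k poly ring)"
  have add: "f + g \<in> ?C" if "f \<in> ?C" "g \<in> ?C" for f g
    using that Poly_Mapping.keys_add[of f g] by (fastforce simp: poly_ring_def)
  have uminus: "- f \<in> ?C" if "f \<in> ?C" for f
    using that by (auto simp: poly_ring_def in_keys_iff)
  have mult: "f * g \<in> ?C" if f: "f \<in> ?C" and g: "g \<in> ?C" for f g
  proof -
    have "Poly_Mapping.keys m \<subseteq> vars_upto n" if "m \<in> Poly_Mapping.keys (f * g)" for m
    proof -
      obtain a b where "m = a + b" "a \<in> Poly_Mapping.keys f" "b \<in> Poly_Mapping.keys g"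
        using \<open>m \<in> _\<close> keys_mult[of f g] by blast
      then show ?thesis
        using f g Poly_Mapping.keys_add[of a b] by (fastforce simp: poly_ring_def)
    qed
    then show ?thesis by (simp add: poly_ring_def)
  qed
  have one: "1 \<in> ?C" and zero: "0 \<in> ?C"
    by (auto simp: poly_ring_def)
  have ops [simp]: "mult (poly_ring n :: 'k poly ring) = (*)" "one (poly_ring n :: 'k poly ring) = 1"
    "Ring.ring.add (poly_ring n :: 'k poly ring) = (+)" "Ring.ring.zero (poly_ring n :: 'k poly ring) = 0"
    by (simp_all add: poly_ring_def)
  have "abelian_group (poly_ring n :: 'k poly ring)"
  proof (rule abelian_groupI)
    fix f assume "f \<in> ?C"
    then show "\<exists>g \<in> ?C. g \<oplus>\<^bsub>poly_ring n\<^esub> f = \<zero>\<^bsub>poly_ring n\<^esub>"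
      using uminus[of f] by (intro bexI[of _ "- f"]) simp_all
  qed (simp_all add: add zero ac_simps)
  moreover have "Group.comm_monoid (poly_ring n :: 'k poly ring)"
    by (rule comm_monoidI) (simp_all add: mult one ac_simps)
  ultimately show ?thesis
    by (rule cringI) (simp add: distrib_right)
qed

end

theory Submission
  imports Defs
begin

text \<open>The generators of \<open>J\<^sub>G\<close> say that the plane vectors \<open>(x\<^sub>i,
  y\<^sub>i)\<close> and \<open>(x\<^sub>j, y\<^sub>j)\<close> at adjacent vertices are parallel. If
  exactly the vectors at a vertex set \<open>A\<close> are nonzero, this means that they have a
  common slope on each connected component of the subgraph induced on \<open>A\<close>. Accordingly
  each \<open>A\<close> has a ring homomorphism \<open>\<phi>\<^sub>A\<close>
  (\<open>comp_map\<close>) that kills the variables outside of \<open>A\<close> and substitutes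
  \<open>y\<^sub>i t\<^sub>C\<close> for \<open>x\<^sub>i\<close>, where \<open>C\<close> is the
  component of \<open>i\<close> in \<open>A\<close>. Its kernel is prime, and
  \<open>edge_ideal_eq_Inter_kernels\<close> shows that \<open>J\<^sub>G\<close> is the intersection
  of all these kernels, for every graph and every field: monomials with support \<open>A\<close>
  that \<open>\<phi>\<^sub>A\<close> identifies are congruent modulo \<open>J\<^sub>G\<close>, by
  exchanging \<open>x\<close> and \<open>y\<close> along paths in \<open>A\<close>.

  Consequently \<open>J\<^sub>G : f\<close> is the intersection of the kernels of those
  \<open>\<phi>\<^sub>B\<close> with \<open>\<phi>\<^sub>B(f) \<noteq> 0\<close>. If it is prime, it
  is the kernel of one \<open>\<phi>\<^sub>A\<close> and is contained in all the others
  (\<open>isolates\<close>). Since the maps respect the \<open>\<nat>\<^sup>n\<close>-grading,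
  \<open>f\<close> may be taken multihomogeneous, of multidegree \<open>a\<close> with support
  \<open>D \<subseteq> A\<close>.

  Lower bound for the cycle. Comparing \<open>A\<close> with suitable sets \<open>B \<supseteq>
  D\<close> yields: every vertex \<open>p \<notin> A\<close> has both neighbours in
  \<open>D\<close>; either \<open>A = D\<close>, or \<open>A\<close> is the whole vertex set and
  \<open>D\<close> misses at most two vertices (\<open>A_eq_D\<close>, \<open>card_D_whole\<close>).
  In the second case the degree is at least \<open>n - 2\<close>, which suffices for \<open>n \<ge>
  6\<close>. In the first case three consecutive vertices have total degree at least two, unless
  \<open>D\<close> again misses only two vertices (\<open>window_ge_2\<close>). The critical pattern
  is \<open>0, 1, 0\<close>: there \<open>f\<close> is linear in the vector at the middle vertex,
  and would vanish at two different slopes of it. Summing over all windows gives \<open>3 deg f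
  \<ge> 2 n\<close>.

  Upper bound. Take \<open>T\<close> to consist of about every third vertex. The product over
  \<open>t \<in> T\<close> of the minors of the two neighbours of \<open>t\<close>, with one more
  variable if \<open>n mod 3 = 1\<close>, is killed by every \<open>\<phi>\<^sub>B\<close> except
  the one for the complement of \<open>T\<close> (\<open>isolates_separator\<close>), and its degree
  is the bound.\<close>

alias lookup = Poly_Mapping.lookup
alias keys = Poly_Mapping.keys
alias single = Poly_Mapping.single

section \<open>Monomials and their multidegrees\<close>

text \<open>Polynomials over a field form a domain as soon as the exponent vectors carry a linear
  order, and these inherit one from the variables.\<close>

instantiation var :: linorder
begin

fun var_code :: "var \<Rightarrow> nat" where
  "var_code (X i) = 2 * i"
| "var_code (Y i) = 2 * i + 1"

definition less_eq_var :: "var \<Rightarrow> var \<Rightarrow> bool" where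
  "v \<le> w \<longleftrightarrow> var_code v \<le> var_code w"

definition less_var :: "var \<Rightarrow> var \<Rightarrow> bool" where
  "v < w \<longleftrightarrow> var_code v < var_code w"

instance
proof
  fix v w :: var
  assume "v \<le> w" "w \<le> v"
  then have "var_code v = var_code w" by (simp add: less_eq_var_def)
  then show "v = w" by (cases v; cases w; simp; presburger)
qed (auto simp: less_eq_var_def less_var_def)

end

text \<open>The \<open>\<nat>\<^sup>n\<close>-grading in which \<open>x\<^sub>i\<close> and
  \<open>y\<^sub>i\<close> both have degree \<open>e\<^sub>i\<close>. Binomial edge ideals are
  homogeneous for it, and it is much finer than the total degree.\<close>

definition mdeg :: "(var \<Rightarrow>\<^sub>0 nat) \<Rightarrow> nat \<Rightarrow> nat" where
  "mdeg m i = lookup m (X i) + lookup m (Y i)"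

definition msupp :: "(var \<Rightarrow>\<^sub>0 nat) \<Rightarrow> nat set" where
  "msupp m = {i. mdeg m i \<noteq> 0}"

lemma mdeg_zero [simp]: "mdeg 0 i = 0"
  and mdeg_add [simp]: "mdeg (m + m') i = mdeg m i + mdeg m' i"
  and mdeg_single_X [simp]: "mdeg (single (X j) k) i = (if i = j then k else 0)"
  and mdeg_single_Y [simp]: "mdeg (single (Y j) k) i = (if i = j then k else 0)"
  by (auto simp: mdeg_def lookup_add lookup_single)

lemma msupp_zero [simp]: "msupp 0 = {}"
  and msupp_add [simp]: "msupp (m + m') = msupp m \<union> msupp m'"
  by (auto simp: msupp_def)

lemma msupp_eq_indices: "msupp m = {i. X i \<in> keys m} \<union> {i. Y i \<in> keys m}"
  by (auto simp: msupp_def mdeg_def in_keys_iff)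

lemma finite_msupp [simp]: "finite (msupp m)"
proof -
  have "finite (X -` keys m)" "finite (Y -` keys m)"
    by (auto intro!: finite_vimageI simp: inj_def)
  then show ?thesis by (simp add: msupp_eq_indices vimage_def)
qed

lemma sum_monomials: "(\<Sum>m\<in>keys f. single m (lookup f m)) = f"
  by (rule poly_mapping_eqI) (auto simp: lookup_sum lookup_single when_def in_keys_iff)

section \<open>Slope maps\<close>

text \<open>The map \<open>y\<^sub>i \<mapsto> y\<^sub>i\<close>, \<open>x\<^sub>i \<mapsto>
  y\<^sub>i t\<^bsub>c i\<^esub>\<close> forces all vectors \<open>(x\<^sub>i, y\<^sub>i)\<close>
  with the same label \<open>c i\<close> to have the same slope \<open>t\<^bsub>c i\<^esub>\<close>.
  The slope variable \<open>t\<^sub>p\<close> is written \<open>X p\<close>, which is free in the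
  image because every original \<open>x\<^sub>i\<close> is substituted; so the map is an
  endomorphism of the polynomial ring.\<close>

fun slope_var :: "(nat \<Rightarrow> nat) \<Rightarrow> var \<Rightarrow> var \<Rightarrow>\<^sub>0 nat" where
  "slope_var c (X i) = single (Y i) 1 + single (X (c i)) 1"
| "slope_var c (Y i) = single (Y i) 1"

definition slope_mon :: "(nat \<Rightarrow> nat) \<Rightarrow> (var \<Rightarrow>\<^sub>0 nat) \<Rightarrow> (var \<Rightarrow>\<^sub>0 nat)" where
  "slope_mon c m = (\<Sum>v\<in>keys m. \<Sum>_<lookup m v. slope_var c v)"

lemma lookup_slope_mon:
  assumes "finite S" "keys m \<subseteq> S"
  shows "lookup (slope_mon c m) w = (\<Sum>v\<in>S. lookup m v * lookup (slope_var c v) w)"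
proof -
  have "lookup (slope_mon c m) w = (\<Sum>v\<in>keys m. lookup m v * lookup (slope_var c v) w)"
    by (simp add: slope_mon_def lookup_sum)
  also have "\<dots> = (\<Sum>v\<in>S. lookup m v * lookup (slope_var c v) w)"
    using assms by (intro sum.mono_neutral_left) (auto simp: in_keys_iff)
  finally show ?thesis .
qed

lemma slope_mon_zero [simp]: "slope_mon c 0 = 0"
  by (simp add: slope_mon_def)

lemma slope_mon_add: "slope_mon c (m + m') = slope_mon c m + slope_mon c m'"
proof (rule poly_mapping_eqI)
  fix w
  let ?S = "keys m \<union> keys m'"
  have "keys (m + m') \<subseteq> ?S" by (rule Poly_Mapping.keys_add)
  then show "lookup (slope_mon c (m + m')) w = lookup (slope_mon c m + slope_mon c m') w"
    by (simp add: lookup_slope_mon[of ?S] lookup_add algebra_simps sum.distrib)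
qed

lemma slope_mon_single [simp]: "slope_mon c (single v 1) = slope_var c v"
  by (simp add: slope_mon_def)

text \<open>A slope map retains the multidegree: it can be read off from the exponents of the
  \<open>y\<^sub>i\<close>. The only other information that survives is the number of
  \<open>x\<close>-factors within each label class.\<close>

lemma lookup_slope_mon_Y: "lookup (slope_mon c m) (Y i) = mdeg m i"
proof -
  let ?S = "keys m \<union> {X i, Y i}"
  have "lookup (slope_mon c m) (Y i) = (\<Sum>v\<in>?S. lookup m v * lookup (slope_var c v) (Y i))"
    by (rule lookup_slope_mon) auto
  also have "\<dots> = (\<Sum>v\<in>{X i, Y i}. lookup m v * lookup (slope_var c v) (Y i))"
  proof (rule sum.mono_neutral_right)
    show "\<forall>v\<in>?S - {X i, Y i}. lookup m v * lookup (slope_var c v) (Y i) = 0"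
    proof
      fix v assume "v \<in> ?S - {X i, Y i}"
      then show "lookup m v * lookup (slope_var c v) (Y i) = 0"
        by (cases v) (auto simp: lookup_add lookup_single)
    qed
  qed auto
  finally show ?thesis by (simp add: mdeg_def lookup_add lookup_single)
qed

lemma lookup_slope_mon_X:
  assumes "finite D" "msupp m \<subseteq> D"
  shows "lookup (slope_mon c m) (X p) = (\<Sum>i | i \<in> D \<and> c i = p. lookup m (X i))"
proof -
  let ?S = "X ` D \<union> Y ` D"
  have "v \<in> ?S" if "v \<in> keys m" for v
    using that assms(2) by (cases v) (auto simp: msupp_eq_indices)
  then have "lookup (slope_mon c m) (X p) = (\<Sum>v\<in>?S. lookup m v * lookup (slope_var c v) (X p))"
    using assms(1) by (intro lookup_slope_mon) auto
  also have "\<dots> = (\<Sum>v\<in>X ` D. lookup m v * lookup (slope_var c v) (X p))"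
    using assms(1) by (intro sum.mono_neutral_right) (auto simp: lookup_single)
  also have "\<dots> = (\<Sum>i\<in>D. if c i = p then lookup m (X i) else 0)"
    by (subst sum.reindex) (auto simp: inj_on_def lookup_add lookup_single when_def intro!: sum.cong)
  also have "\<dots> = (\<Sum>i | i \<in> D \<and> c i = p. lookup m (X i))"
    using assms(1) by (simp add: sum.inter_filter)
  finally show ?thesis .
qed

lemma msupp_slope_mon_cong:
  assumes "slope_mon c m = slope_mon c' m'"
  shows "mdeg m = mdeg m'" "msupp m = msupp m'"
proof -
  show "mdeg m = mdeg m'"
    using assms lookup_slope_mon_Y by (metis ext)
  then show "msupp m = msupp m'" by (simp add: msupp_def)
qed

text \<open>The set \<open>A\<close> lists the indices whose vector \<open>(x\<^sub>i,
  y\<^sub>i)\<close> is allowed to be nonzero: the other variables are sent to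
  \<open>0\<close>.\<close>

definition slope :: "nat set \<Rightarrow> (nat \<Rightarrow> nat) \<Rightarrow> 'k::field poly \<Rightarrow> 'k poly" where
  "slope A c f =
     (\<Sum>m\<in>keys f. if msupp m \<subseteq> A then single (slope_mon c m) (lookup f m) else 0)"

lemma slope_superset:
  assumes "finite S" "keys f \<subseteq> S"
  shows "slope A c f = (\<Sum>m\<in>S. if msupp m \<subseteq> A then single (slope_mon c m) (lookup f m) else 0)"
  unfolding slope_def using assms by (intro sum.mono_neutral_left) (auto simp: in_keys_iff)

lemma slope_zero [simp]: "slope A c 0 = 0"
  by (simp add: slope_def)

lemma slope_add: "slope A c (f + g) = slope A c f + slope A c g"
proof -
  let ?S = "keys f \<union> keys g"
  have "keys (f + g) \<subseteq> ?S" by (rule Poly_Mapping.keys_add)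
  then show ?thesis
    by (auto simp: slope_superset[of ?S] lookup_add single_add sum.distrib[symmetric]
        intro!: sum.cong)
qed

lemma slope_sum: "slope A c (\<Sum>x\<in>S. h x) = (\<Sum>x\<in>S. slope A c (h x))"
  by (induction S rule: infinite_finite_induct) (simp_all add: slope_add)

lemma slope_uminus: "slope A c (- f) = - slope A c f"
  using slope_add[of A c f "- f"] by (simp add: eq_neg_iff_add_eq_0 add.commute)

lemma slope_diff: "slope A c (f - g) = slope A c f - slope A c g"
  using slope_add[of A c f "- g"] by (simp add: slope_uminus)

lemma slope_single:
  "slope A c (single m k) = (if msupp m \<subseteq> A then single (slope_mon c m) k else 0)"
  by (cases "k = 0") (simp_all add: slope_def)

lemma slope_one [simp]: "slope A c 1 = 1"
  using slope_single[of A c 0 1] by simp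

lemma slope_mult: "slope A c (f * g) = slope A c f * slope A c g"
proof -
  let ?t = "\<lambda>f m. single m (lookup f m)"
  have mono: "slope A c (single m k * single m' k') = slope A c (single m k) * slope A c (single m' k')"
    for m m' and k k' :: 'a
    by (simp add: mult_single slope_single slope_mon_add)
  have "slope A c (f * g) = slope A c ((\<Sum>m\<in>keys f. ?t f m) * (\<Sum>m\<in>keys g. ?t g m))"
    by (simp only: sum_monomials)
  also have "\<dots> = (\<Sum>m\<in>keys f. slope A c (?t f m)) * (\<Sum>m\<in>keys g. slope A c (?t g m))"
    by (simp add: sum_product slope_sum mono)
  also have "\<dots> = slope A c f * slope A c g"
    by (simp only: slope_sum[symmetric] sum_monomials)
  finally show ?thesis .
qed

lemma slope_prod: "slope A c (\<Prod>x\<in>S. h x) = (\<Prod>x\<in>S. slope A c (h x))"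
  by (induction S rule: infinite_finite_induct) (simp_all add: slope_mult)

lemma slope_indet_X:
  "slope A c (indet (X i)) = (if i \<in> A then indet (Y i) * indet (X (c i)) else 0)"
  and slope_indet_Y: "slope A c (indet (Y i)) = (if i \<in> A then indet (Y i) else 0)"
  by (auto simp: indet_def slope_single msupp_def mult_single slope_mon_single[simplified])

text \<open>Since monomials go to monomials or to \<open>0\<close>, membership in the kernel is a
  linear condition: the coefficients of the monomials in each fibre add up to
  \<open>0\<close>.\<close>

lemma lookup_slope:
  "lookup (slope A c f) q = (\<Sum>m | m \<in> keys f \<and> msupp m \<subseteq> A \<and> slope_mon c m = q. lookup f m)"
proof -
  have "lookup (slope A c f) q
      = (\<Sum>m\<in>keys f. if msupp m \<subseteq> A \<and> slope_mon c m = q then lookup f m else 0)"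
    by (auto simp: slope_def lookup_sum lookup_single when_def intro!: sum.cong)
  then show ?thesis by (simp add: sum.inter_filter)
qed

lemma indet_nonzero [simp]: "(indet v :: 'k::field poly) \<noteq> 0"
  by (metis indet_def lookup_single_eq lookup_zero zero_neq_one)

lemma indet_eq_iff [simp]: "(indet v :: 'k::field poly) = indet w \<longleftrightarrow> v = w"
proof
  assume "(indet v :: 'k poly) = indet w"
  then have "keys (indet v :: 'k poly) = keys (indet w :: 'k poly)" by simp
  then have "single v (1::nat) = single w 1" by (simp add: indet_def)
  then have "keys (single v (1::nat)) = keys (single w (1::nat))" by simp
  then show "v = w" by simp
qed simp

text \<open>The fibres of a coarser map are disjoint unions of fibres of the finer one.\<close>

lemma sum_fibres_refine:
  fixes h h' :: "'a \<Rightarrow> 'b::comm_monoid_add"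
  assumes "finite S"
    and refine: "\<And>x y. x \<in> S \<Longrightarrow> y \<in> S \<Longrightarrow> c x = c y \<Longrightarrow> c' x = c' y"
    and eq: "\<And>p. (\<Sum>x | x \<in> S \<and> c x = p. h x) = (\<Sum>x | x \<in> S \<and> c x = p. h' x)"
  shows "(\<Sum>x | x \<in> S \<and> c' x = q. h x) = (\<Sum>x | x \<in> S \<and> c' x = q. h' x)"
proof -
  let ?F = "{x \<in> S. c' x = q}"
  have fib: "{x \<in> ?F. c x = p} = {x \<in> S. c x = p}" if "p \<in> c ` ?F" for p
    using that refine by auto
  have "sum k ?F = (\<Sum>p\<in>c ` ?F. \<Sum>x | x \<in> S \<and> c x = p. k x)" for k :: "'a \<Rightarrow> 'b"
  proof -
    have "sum k ?F = (\<Sum>p\<in>c ` ?F. sum k {x \<in> ?F. c x = p})"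
      using assms(1) by (intro sum.image_gen) simp
    then show ?thesis using fib by (metis (no_types, lifting) sum.cong)
  qed
  then show ?thesis by (simp add: eq)
qed

text \<open>A labelling that identifies more indices is a specialisation of the slopes, so vanishing
  passes from the finer labelling to the coarser one. Only the labels on the indices that occur in
  \<open>f\<close> matter; this is what allows vertex sets to be exchanged for one another
  below.\<close>

lemma slope_eq_0_coarsen:
  assumes "finite D" "\<And>m. m \<in> keys f \<Longrightarrow> msupp m \<subseteq> D" "D \<subseteq> A" "D \<subseteq> A'"
    and refine: "\<And>i j. i \<in> D \<Longrightarrow> j \<in> D \<Longrightarrow> c i = c j \<Longrightarrow> c' i = c' j"
    and zero: "slope A c f = 0"
  shows "slope A' c' f = 0"
proof (rule poly_mapping_eqI)
  fix q
  have coarse: "slope_mon c' m = slope_mon c' m'"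
    if m: "m \<in> keys f" "m' \<in> keys f" and eq: "slope_mon c m = slope_mon c m'" for m m'
  proof (rule poly_mapping_eqI)
    fix w
    have sub: "msupp m \<subseteq> D" "msupp m' \<subseteq> D" using m assms(2) by auto
    show "lookup (slope_mon c' m) w = lookup (slope_mon c' m') w"
    proof (cases w)
      case (Y i)
      then show ?thesis
        using msupp_slope_mon_cong(1)[OF eq] by (simp add: lookup_slope_mon_Y)
    next
      case (X p)
      have fib: "(\<Sum>i | i \<in> D \<and> c i = p. lookup m (X i)) = (\<Sum>i | i \<in> D \<and> c i = p. lookup m' (X i))" for p
        using arg_cong[OF eq, of "\<lambda>n. lookup n (X p)"] by (simp add: lookup_slope_mon_X[OF assms(1)] sub)
      have "(\<Sum>i | i \<in> D \<and> c' i = p. lookup m (X i)) = (\<Sum>i | i \<in> D \<and> c' i = p. lookup m' (X i))" for p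
        by (rule sum_fibres_refine[where c = c, OF assms(1) refine fib])
      then show ?thesis by (simp add: X lookup_slope_mon_X[OF assms(1)] sub)
    qed
  qed
  have fibre: "(\<Sum>m | m \<in> keys f \<and> slope_mon c m = q. lookup f m) = (\<Sum>m | m \<in> keys f \<and> slope_mon c m = q. 0)" for q
  proof -
    have "{m \<in> keys f. slope_mon c m = q} = {m. m \<in> keys f \<and> msupp m \<subseteq> A \<and> slope_mon c m = q}"
      using assms(2,3) by auto
    then show ?thesis using lookup_slope[of A c f q] zero by simp
  qed
  have "lookup (slope A' c' f) q = (\<Sum>m | m \<in> keys f \<and> slope_mon c' m = q. lookup f m)"
    unfolding lookup_slope using assms(2,4) by (intro sum.cong) auto
  also have "\<dots> = (\<Sum>m | m \<in> keys f \<and> slope_mon c' m = q. 0)"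
    by (rule sum_fibres_refine[where c = "slope_mon c", OF finite_keys coarse fibre])
  finally show "lookup (slope A' c' f) q = lookup 0 q" by simp
qed

section \<open>Connectivity inside a vertex set\<close>

definition linked :: "nat set set \<Rightarrow> nat set \<Rightarrow> nat \<Rightarrow> nat \<Rightarrow> bool" where
  "linked E A = (\<lambda>i j. i \<in> A \<and> j \<in> A \<and> {i, j} \<in> E)\<^sup>*\<^sup>*"

lemma linked_refl [simp]: "linked E A i i"
  by (simp add: linked_def)

lemma linked_edge: "i \<in> A \<Longrightarrow> j \<in> A \<Longrightarrow> {i, j} \<in> E \<Longrightarrow> linked E A i j"
  by (auto simp: linked_def)

lemma linked_trans: "linked E A i j \<Longrightarrow> linked E A j k \<Longrightarrow> linked E A i k"
  by (simp add: linked_def)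

lemma linked_sym: "linked E A i j \<Longrightarrow> linked E A j i"
proof -
  have "symp (\<lambda>i j. i \<in> A \<and> j \<in> A \<and> {i, j} \<in> E)"
    by (auto simp: symp_def insert_commute)
  then show "linked E A i j \<Longrightarrow> linked E A j i"
    unfolding linked_def by (meson sympD symp_rtranclp)
qed

lemma linked_mono: "linked E A i j \<Longrightarrow> A \<subseteq> B \<Longrightarrow> linked E B i j"
  unfolding linked_def by (erule rtranclp_mono[THEN predicate2D, rotated]) auto

lemma linked_invariant:
  assumes "linked E A i j" "\<And>u v. u \<in> A \<Longrightarrow> v \<in> A \<Longrightarrow> {u, v} \<in> E \<Longrightarrow> g u = g v"
  shows "g i = g j"
  using assms(1) unfolding linked_def
  by (induction rule: rtranclp_induct) (use assms(2) in auto)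

text \<open>A new vertex can only join components that contain neighbours of it.\<close>

lemma linked_insert:
  assumes "linked E (insert p D) i j" "i \<in> D" "j \<in> D"
    and nbrs: "\<And>u v. u \<in> D \<Longrightarrow> v \<in> D \<Longrightarrow> {u, p} \<in> E \<Longrightarrow> {v, p} \<in> E \<Longrightarrow> linked E D u v"
  shows "linked E D i j"
proof (cases "p \<in> D")
  case True
  then show ?thesis using assms(1) by (simp add: insert_absorb)
next
  case False
  have "(k \<in> D \<longrightarrow> linked E D i k) \<and> (k = p \<longrightarrow> (\<exists>u\<in>D. {u, p} \<in> E \<and> linked E D i u))"
    if "linked E (insert p D) i k" for k
    using that unfolding linked_def[of E "insert p D"]
  proof (induction rule: rtranclp_induct)
    case base
    then show ?case using \<open>i \<in> D\<close> False by auto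
  next
    case (step k l)
    show ?case
    proof (intro conjI impI)
      assume l: "l \<in> D"
      show "linked E D i l"
      proof (cases "k = p")
        case True
        then obtain u where u: "u \<in> D" "{u, p} \<in> E" "linked E D i u" using step.IH by blast
        moreover have "{l, p} \<in> E" using step.hyps True by (simp add: insert_commute)
        ultimately show ?thesis using nbrs[of u l] l linked_trans by blast
      next
        case False
        then have k: "k \<in> D" "{k, l} \<in> E" using step.hyps by auto
        then have "linked E D i k" using step.IH by simp
        then show ?thesis using linked_edge[OF k(1) l k(2)] by (rule linked_trans)
      qed
    next
      assume l: "l = p"
      show "\<exists>u\<in>D. {u, p} \<in> E \<and> linked E D i u"
      proof (cases "k = p")
        case True
        then show ?thesis using step.IH by blast
      next
        case False
        then have "k \<in> D" "{k, p} \<in> E" using step.hyps l by auto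
        then show ?thesis using step.IH by blast
      qed
    qed
  qed
  then show ?thesis using assms(1,3) by blast
qed

definition label :: "nat set set \<Rightarrow> nat set \<Rightarrow> nat \<Rightarrow> nat" where
  "label E A i = (LEAST j. linked E A i j)"

lemma label_eq_iff: "label E A i = label E A j \<longleftrightarrow> linked E A i j"
proof
  assume eq: "label E A i = label E A j"
  have "linked E A k (label E A k)" for k
    unfolding label_def by (rule LeastI[of _ k]) simp
  then show "linked E A i j"
    using eq linked_sym linked_trans by metis
next
  assume "linked E A i j"
  then have "linked E A i k \<longleftrightarrow> linked E A j k" for k
    using linked_sym linked_trans by blast
  then show "label E A i = label E A j" by (simp add: label_def)
qed

section \<open>Binomial edge ideals as intersections of toric primes\<close>

definition minor :: "nat \<Rightarrow> nat \<Rightarrow> 'k::field poly" where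
  "minor i j = indet (X i) * indet (Y j) - indet (X j) * indet (Y i)"

text \<open>Evaluation at the generic point of a family of solutions of the equations of
  \<open>J\<^sub>G\<close>: the vectors at vertices outside \<open>A\<close> vanish, and the others
  have one common slope on each component of the subgraph induced on \<open>A\<close>.\<close>

definition comp_map :: "nat set set \<Rightarrow> nat set \<Rightarrow> 'k::field poly \<Rightarrow> 'k poly" where
  "comp_map E A = slope A (label E A)"

lemma slope_minor:
  "slope A c (minor i j) =
     (if i \<in> A \<and> j \<in> A then indet (Y i) * indet (Y j) * (indet (X (c i)) - indet (X (c j))) else 0)"
  by (auto simp: minor_def slope_diff slope_mult slope_indet_X slope_indet_Y algebra_simps)

lemma comp_map_minor_eq_0_iff:
  "comp_map E A (minor i j :: 'k::field poly) = 0 \<longleftrightarrow> i \<notin> A \<or> j \<notin> A \<or> linked E A i j"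
  by (auto simp: comp_map_def slope_minor label_eq_iff)

lemma comp_map_indet_eq_0_iff:
  "comp_map E A (indet (X i) :: 'k::field poly) = 0 \<longleftrightarrow> i \<notin> A"
  by (auto simp: comp_map_def slope_indet_X)

lemma poly_ring_simps [simp]:
  "mult (poly_ring n) = (*)" "one (poly_ring n) = 1"
  "Ring.ring.add (poly_ring n) = (+)" "Ring.ring.zero (poly_ring n) = 0"
  by (simp_all add: poly_ring_def)

lemma carrier_poly_ring:
  "carrier (poly_ring n) = {f. \<forall>m\<in>keys f. msupp m \<subseteq> {1..n}}"
proof -
  have "keys m \<subseteq> vars_upto n \<longleftrightarrow> msupp m \<subseteq> {1..n}" for m :: "var \<Rightarrow>\<^sub>0 nat"
  proof
    show "keys m \<subseteq> vars_upto n \<Longrightarrow> msupp m \<subseteq> {1..n}"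
      by (auto simp: vars_upto_def msupp_eq_indices)
    assume sub: "msupp m \<subseteq> {1..n}"
    show "keys m \<subseteq> vars_upto n"
    proof
      fix v assume "v \<in> keys m"
      then show "v \<in> vars_upto n"
        using sub by (cases v) (auto simp: vars_upto_def msupp_eq_indices)
    qed
  qed
  then show ?thesis by (simp add: poly_ring_def)
qed

lemma
  shows add_carrier: "f \<in> carrier (poly_ring n) \<Longrightarrow> g \<in> carrier (poly_ring n) \<Longrightarrow> f + g \<in> carrier (poly_ring n)"
    and mult_carrier: "f \<in> carrier (poly_ring n) \<Longrightarrow> g \<in> carrier (poly_ring n) \<Longrightarrow> f * g \<in> carrier (poly_ring n)"
    and zero_carrier [simp]: "0 \<in> carrier (poly_ring n)"
    and one_carrier [simp]: "1 \<in> carrier (poly_ring n)"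
proof -
  interpret cring "poly_ring n :: 'a poly ring" by (rule cring_poly_ring)
  show "f \<in> carrier (poly_ring n) \<Longrightarrow> g \<in> carrier (poly_ring n) \<Longrightarrow> f + g \<in> carrier (poly_ring n)"
    using a_closed[of f g] by simp
  show "f \<in> carrier (poly_ring n) \<Longrightarrow> g \<in> carrier (poly_ring n) \<Longrightarrow> f * g \<in> carrier (poly_ring n)"
    using m_closed[of f g] by simp
qed (simp_all add: carrier_poly_ring)

lemma single_carrier: "msupp m \<subseteq> {1..n} \<Longrightarrow> single m k \<in> carrier (poly_ring n)"
  by (simp add: carrier_poly_ring)

lemma uminus_carrier: "f \<in> carrier (poly_ring n) \<Longrightarrow> - f \<in> carrier (poly_ring n)"
  by (simp add: carrier_poly_ring in_keys_iff)

lemma diff_carrier: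
  "f \<in> carrier (poly_ring n) \<Longrightarrow> g \<in> carrier (poly_ring n) \<Longrightarrow> f - g \<in> carrier (poly_ring n)"
  using add_carrier[of f n "- g"] uminus_carrier[of g n] by simp

lemma indet_carrier:
  "i \<in> {1..n} \<Longrightarrow> indet (X i) \<in> carrier (poly_ring n)"
  "i \<in> {1..n} \<Longrightarrow> indet (Y i) \<in> carrier (poly_ring n)"
  by (auto simp: indet_def msupp_def intro!: single_carrier split: if_splits)

lemma minor_carrier:
  "i \<in> {1..n} \<Longrightarrow> j \<in> {1..n} \<Longrightarrow> minor i j \<in> carrier (poly_ring n)"
  unfolding minor_def by (intro diff_carrier mult_carrier indet_carrier)

definition comp_kernel :: "nat \<Rightarrow> nat set set \<Rightarrow> nat set \<Rightarrow> 'k::field poly set" where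
  "comp_kernel n E A = {g \<in> carrier (poly_ring n). comp_map E A g = 0}"

lemma ideal_comp_kernel: "ideal (comp_kernel n E A :: 'k::field poly set) (poly_ring n)"
proof -
  interpret cring "poly_ring n :: 'k poly ring" by (rule cring_poly_ring)
  have neg: "\<ominus>\<^bsub>poly_ring n\<^esub> f = - f" if "f \<in> carrier (poly_ring n)" for f :: "'k poly"
    using that minus_equality[of "- f" f] uminus_carrier[of f n] by simp
  have "subgroup (comp_kernel n E A) (add_monoid (poly_ring n :: 'k poly ring))"
    by (rule subgroup.intro)
      (auto simp: comp_kernel_def comp_map_def slope_add slope_uminus add_carrier uminus_carrier
        neg[unfolded a_inv_def, simplified])
  then show ?thesis
    by (intro idealI ring_axioms)
      (auto simp: comp_kernel_def comp_map_def slope_mult mult_carrier)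
qed

lemma primeideal_comp_kernel: "primeideal (comp_kernel n E A :: 'k::field poly set) (poly_ring n)"
proof (rule primeidealI)
  show "ideal (comp_kernel n E A :: 'k poly set) (poly_ring n)" by (rule ideal_comp_kernel)
  show "cring (poly_ring n :: 'k poly ring)" by (rule cring_poly_ring)
  have "1 \<in> carrier (poly_ring n :: 'k poly ring)" "1 \<notin> (comp_kernel n E A :: 'k poly set)"
    by (auto simp: comp_kernel_def comp_map_def)
  then show "carrier (poly_ring n) \<noteq> (comp_kernel n E A :: 'k poly set)" by blast
qed (auto simp: comp_kernel_def comp_map_def slope_mult)

locale graph_on =
  fixes n :: nat and E :: "nat set set"
  assumes edge_bound: "{i, j} \<in> E \<Longrightarrow> i \<in> {1..n}"
begin

abbreviation edge_ideal :: "'k::field poly set" where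
  "edge_ideal \<equiv> binomial_edge_ideal n E"

lemma edge_bound2: "{i, j} \<in> E \<Longrightarrow> j \<in> {1..n}"
  using edge_bound[of j i] by (simp add: insert_commute)

lemma generators_carrier:
  "{minor i j | i j. {i, j} \<in> E} \<subseteq> (carrier (poly_ring n) :: 'k::field poly set)"
  using edge_bound edge_bound2 minor_carrier by blast

lemma edge_ideal_eq: "edge_ideal = Idl\<^bsub>poly_ring n\<^esub> {minor i j | i j. {i, j} \<in> E}"
  by (simp add: binomial_edge_ideal_def minor_def)

lemma ideal_edge_ideal: "ideal (edge_ideal :: 'k::field poly set) (poly_ring n)"
  unfolding edge_ideal_eq
  using cring.axioms(1)[OF cring_poly_ring] generators_carrier by (rule ring.genideal_ideal)

lemma minor_in_edge_ideal: "{i, j} \<in> E \<Longrightarrow> minor i j \<in> edge_ideal"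
  unfolding edge_ideal_eq
  using ring.genideal_self[OF cring.axioms(1)[OF cring_poly_ring] generators_carrier] by blast

lemma edge_ideal_add: "f \<in> edge_ideal \<Longrightarrow> g \<in> edge_ideal \<Longrightarrow> f + g \<in> edge_ideal"
  using additive_subgroup.a_closed[OF ideal.axioms(1)[OF ideal_edge_ideal]] by fastforce

lemma edge_ideal_zero: "0 \<in> edge_ideal"
  using additive_subgroup.zero_closed[OF ideal.axioms(1)[OF ideal_edge_ideal]] by fastforce

lemma edge_ideal_mult: "g \<in> carrier (poly_ring n) \<Longrightarrow> f \<in> edge_ideal \<Longrightarrow> g * f \<in> edge_ideal"
  using ideal.I_l_closed[OF ideal_edge_ideal] by fastforce

lemma edge_ideal_sum: "(\<And>x. x \<in> S \<Longrightarrow> h x \<in> edge_ideal) \<Longrightarrow> (\<Sum>x\<in>S. h x) \<in> edge_ideal"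
  by (induction S rule: infinite_finite_induct) (auto simp: edge_ideal_zero edge_ideal_add)

lemma edge_ideal_subset_kernel: "(edge_ideal :: 'k::field poly set) \<subseteq> comp_kernel n E A"
  unfolding edge_ideal_eq
proof (rule ring.genideal_minimal[OF cring.axioms(1)[OF cring_poly_ring] ideal_comp_kernel])
  show "{minor i j | i j. {i, j} \<in> E} \<subseteq> (comp_kernel n E A :: 'k poly set)"
    using generators_carrier linked_edge
    by (fastforce simp: comp_kernel_def comp_map_minor_eq_0_iff)
qed

text \<open>Write \<open>[i,j]\<close> for the minor of \<open>i\<close> and \<open>j\<close>. Along
  a path \<open>i, k, \<dots>, j\<close> the syzygy \<open>z\<^sub>k [i,j] = z\<^sub>i [k,j] +
  z\<^sub>j [i,k]\<close>, valid for \<open>z = x\<close> and for \<open>z = y\<close>, trades one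
  variable at \<open>k\<close> for a step along the path. Hence \<open>[i,j]\<close> lies in the
  ideal after multiplication with a monomial that contains a variable at each inner vertex. Asking
  for a variable at every other vertex of \<open>A\<close> keeps this condition independent of the
  path.\<close>

lemma monomial_minor_in_edge_ideal:
  assumes "linked E A i j" "A \<subseteq> {1..n}" "j \<in> A"
    and "msupp w \<subseteq> {1..n}" "A \<subseteq> msupp w \<union> {i, j}"
  shows "single w 1 * minor i j \<in> (edge_ideal :: 'k::field poly set)"
  using assms(1,4,5) unfolding linked_def
proof (induction arbitrary: w rule: converse_rtranclp_induct)
  case base
  then show ?case by (simp add: minor_def edge_ideal_zero)
next
  case (step i k)
  have edge: "i \<in> A" "k \<in> A" "{i, k} \<in> E" using step.hyps by auto
  consider "i = j" | "k = i" | "k = j" | "i \<noteq> j" "k \<noteq> i" "k \<noteq> j" by blast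
  then show ?case
  proof cases
    case 1
    then show ?thesis by (simp add: minor_def edge_ideal_zero)
  next
    case 2
    then show ?thesis using step by simp
  next
    case 3
    then show ?thesis
      using edge step.prems(1) by (simp add: edge_ideal_mult single_carrier minor_in_edge_ideal)
  next
    case 4
    \<comment> \<open>the induction step for a variable at \<open>k\<close>; it is used with \<open>u = X\<close> and with \<open>u = Y\<close>\<close>
    have move: "single (w' + u k) 1 * minor i j \<in> (edge_ideal :: 'k poly set)"
      if w: "w = w' + u k"
        and u: "\<And>l. msupp (u l) = {l}"
        and syz: "single (u k) 1 * minor i j
              = single (u i) 1 * minor k j + single (u j) 1 * (minor i k :: 'k poly)"
      for w' and u :: "nat \<Rightarrow> var \<Rightarrow>\<^sub>0 nat"
    proof -
      have sub: "msupp w' \<subseteq> {1..n}" "A \<subseteq> msupp w' \<union> {i, k, j}"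
        using w u step.prems by auto
      have "single (w' + u i) 1 * minor k j \<in> (edge_ideal :: 'k poly set)"
        using sub edge assms(2) u by (intro step.IH) auto
      moreover have "single (w' + u j) 1 * minor i k \<in> (edge_ideal :: 'k poly set)"
        using sub edge assms(2,3) u
        by (intro edge_ideal_mult single_carrier minor_in_edge_ideal) auto
      moreover have "single (w' + u k) 1 * minor i j
          = single (w' + u i) 1 * minor k j + single (w' + u j) 1 * (minor i k :: 'k poly)"
        using arg_cong[OF syz, of "\<lambda>h. single w' 1 * h"]
        by (simp add: distrib_left mult.assoc[symmetric] mult_single)
      ultimately show ?thesis by (simp add: edge_ideal_add)
    qed
    have "k \<in> msupp w" using edge 4 step.prems(2) by blast
    then consider "lookup w (X k) \<noteq> 0" | "lookup w (Y k) \<noteq> 0"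
      by (auto simp: msupp_def mdeg_def)
    then show ?thesis
    proof cases
      case 1
      have "w = (w - single (X k) 1) + single (X k) 1"
        using 1 by (intro poly_mapping_eqI) (auto simp: lookup_add lookup_minus lookup_single when_def)
      moreover have "single (single (X k) 1) 1 * minor i j = single (single (X i) 1) 1 * minor k j
          + single (single (X j) 1) 1 * (minor i k :: 'k poly)"
        unfolding minor_def indet_def by (simp add: algebra_simps)
      ultimately show ?thesis
        using move[of "w - single (X k) 1" "\<lambda>l. single (X l) 1"] by (auto simp: msupp_def)
    next
      case 2
      have "w = (w - single (Y k) 1) + single (Y k) 1"
        using 2 by (intro poly_mapping_eqI) (auto simp: lookup_add lookup_minus lookup_single when_def)
      moreover have "single (single (Y k) 1) 1 * minor i j = single (single (Y i) 1) 1 * minor k j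
          + single (single (Y j) 1) 1 * (minor i k :: 'k poly)"
        unfolding minor_def indet_def by (simp add: algebra_simps)
      ultimately show ?thesis
        using move[of "w - single (Y k) 1" "\<lambda>l. single (Y l) 1"] by (auto simp: msupp_def)
    qed
  qed
qed

text \<open>Two monomials of equal multidegree with equally many \<open>x\<close>-factors in each
  component of the support can be transformed into each other by swaps \<open>x\<^sub>i y\<^sub>j
  \<rightarrow> x\<^sub>j y\<^sub>i\<close> inside components. Each swap changes the monomial by a
  multiple of \<open>[i,j]\<close> that the preceding lemma covers, because the monomial has full
  support.\<close>

lemma monomial_congruence:
  assumes "msupp m = A" "A \<subseteq> {1..n}"
    and "slope_mon (label E A) m = slope_mon (label E A) m'"
  shows "single m 1 - single m' 1 \<in> (edge_ideal :: 'k::field poly set)"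
  using assms
proof (induction "\<Sum>i\<in>A. lookup m (X i) - lookup m' (X i)" arbitrary: m rule: less_induct)
  case less
  let ?c = "label E A"
  have fin: "finite A" using less.prems(1) finite_msupp by blast
  have deg: "mdeg m = mdeg m'" and supp': "msupp m' = A"
    using msupp_slope_mon_cong[OF less.prems(3)] less.prems(1) by auto
  have fibre: "(\<Sum>i | i \<in> A \<and> ?c i = p. lookup m (X i)) = (\<Sum>i | i \<in> A \<and> ?c i = p. lookup m' (X i))" for p
    using arg_cong[OF less.prems(3), of "\<lambda>q. lookup q (X p)"]
    by (simp add: lookup_slope_mon_X[OF fin] less.prems(1) supp')
  show ?case
  proof (cases "\<exists>i\<in>A. lookup m' (X i) < lookup m (X i)")
    case False
    have eqX: "lookup m (X i) = lookup m' (X i)" for i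
    proof (cases "i \<in> A")
      case True
      show ?thesis
        by (rule sum_mono_inv[OF fibre[of "?c i"]]) (use False True fin in \<open>auto simp: not_less\<close>)
    next
      case False
      then show ?thesis using less.prems(1) supp' by (auto simp: msupp_def mdeg_def)
    qed
    have eqY: "lookup m (Y i) = lookup m' (Y i)" for i
      using fun_cong[OF deg, of i] eqX[of i] by (simp add: mdeg_def)
    have "m = m'"
    proof (rule poly_mapping_eqI)
      fix v show "lookup m v = lookup m' v" using eqX eqY by (cases v) auto
    qed
    then show ?thesis by (simp add: edge_ideal_zero)
  next
    case True
    then obtain i where i: "i \<in> A" "lookup m' (X i) < lookup m (X i)" by blast
    \<comment> \<open>the component of \<open>i\<close> has the same number of \<open>x\<close>-factors in \<open>m\<close> and in \<open>m'\<close>\<close>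
    have "\<exists>j\<in>{j \<in> A. ?c j = ?c i}. lookup m (X j) < lookup m' (X j)"
    proof (rule ccontr)
      assume "\<not> ?thesis"
      then have "(\<Sum>j | j \<in> A \<and> ?c j = ?c i. lookup m' (X j)) < (\<Sum>j | j \<in> A \<and> ?c j = ?c i. lookup m (X j))"
        using i fin by (intro sum_strict_mono_ex1) (auto simp: not_less)
      then show False using fibre[of "?c i"] by simp
    qed
    then obtain j where j: "j \<in> A" "?c j = ?c i" "lookup m (X j) < lookup m' (X j)" by blast
    then have ij: "i \<noteq> j" using i by auto
    have "lookup m (Y j) \<noteq> 0" using fun_cong[OF deg, of j] j(3) by (simp add: mdeg_def)
    define w where "w = m - single (X i) 1 - single (Y j) 1"
    define m1 where "m1 = w + (single (X j) 1 + single (Y i) 1)"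
    have m: "m = w + (single (X i) 1 + single (Y j) 1)"
      unfolding w_def using i(2) \<open>lookup m (Y j) \<noteq> 0\<close>
      by (intro poly_mapping_eqI) (auto simp: lookup_add lookup_minus lookup_single when_def)
    have slope1: "slope_mon ?c m1 = slope_mon ?c m"
      unfolding m m1_def slope_mon_add using j(2) by (simp add: add_ac slope_mon_single[simplified])
    have cover: "msupp w \<subseteq> A" "A \<subseteq> msupp w \<union> {i, j}"
      using less.prems(1) unfolding m by (auto simp: msupp_def)
    have "single w 1 * minor i j \<in> (edge_ideal :: 'k poly set)"
      using cover i j less.prems(2) label_eq_iff[of E A i j]
      by (intro monomial_minor_in_edge_ideal[of A]) auto
    moreover have "single w 1 * minor i j = single m 1 - (single m1 1 :: 'k poly)"
      unfolding m m1_def minor_def indet_def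
      by (simp add: right_diff_distrib mult_single add_ac)
    moreover have "single m1 1 - single m' 1 \<in> (edge_ideal :: 'k poly set)"
    proof (rule less.hyps)
      have m1X: "lookup m1 (X k) = (if k = i then lookup m (X k) - 1
          else if k = j then lookup m (X k) + 1 else lookup m (X k))" for k
        unfolding m m1_def using ij by (auto simp: lookup_add lookup_single when_def)
      show "(\<Sum>i\<in>A. lookup m1 (X i) - lookup m' (X i)) < (\<Sum>i\<in>A. lookup m (X i) - lookup m' (X i))"
      proof (rule sum_strict_mono_ex1)
        show "\<exists>k\<in>A. lookup m1 (X k) - lookup m' (X k) < lookup m (X k) - lookup m' (X k)"
          using i by (intro bexI[of _ i]) (auto simp: m1X)
      qed (use fin j in \<open>auto simp: m1X\<close>)
      show "msupp m1 = A" using msupp_slope_mon_cong(2)[OF slope1] less.prems(1) by simp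
    qed (use less.prems slope1 in auto)
    ultimately show ?thesis using edge_ideal_add by fastforce
  qed
qed

text \<open>This holds for every graph. If all component maps kill \<open>f\<close>, consider the
  terms of \<open>f\<close> whose monomials have support \<open>A\<close> and the same image under
  the map of \<open>A\<close>: their coefficients add up to \<open>0\<close>, and their monomials
  are congruent modulo the ideal. In each multidegree the map of the support decides.\<close>

theorem edge_ideal_eq_Inter_kernels:
  "(edge_ideal :: 'k::field poly set) = (\<Inter>A\<in>Pow {1..n}. comp_kernel n E A)"
proof
  show "(edge_ideal :: 'k poly set) \<subseteq> (\<Inter>A\<in>Pow {1..n}. comp_kernel n E A)"
    using edge_ideal_subset_kernel by blast
  show "(\<Inter>A\<in>Pow {1..n}. comp_kernel n E A) \<subseteq> (edge_ideal :: 'k poly set)"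
  proof
    fix f :: "'k poly"
    assume f: "f \<in> (\<Inter>A\<in>Pow {1..n}. comp_kernel n E A)"
    have supp: "msupp m \<subseteq> {1..n}" if "m \<in> keys f" for m
    proof -
      have "f \<in> carrier (poly_ring n)" using f by (auto simp: comp_kernel_def)
      then show ?thesis using that by (auto simp: carrier_poly_ring)
    qed
    define q where "q m = slope_mon (label E (msupp m)) m" for m
    have fibre_in: "(\<Sum>m | m \<in> keys f \<and> q m = q r. single m (lookup f m)) \<in> edge_ideal"
      if r: "r \<in> keys f" for r
    proof -
      let ?A = "msupp r" and ?C = "{m \<in> keys f. q m = q r}"
      have C: "?C = {m. m \<in> keys f \<and> msupp m \<subseteq> ?A \<and> slope_mon (label E ?A) m = q r}"
      proof -
        have "q m = q r \<longleftrightarrow> msupp m \<subseteq> ?A \<and> slope_mon (label E ?A) m = q r" for m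
        proof
          assume eq: "q m = q r"
          then have "msupp m = ?A" unfolding q_def by (rule msupp_slope_mon_cong(2))
          then show "msupp m \<subseteq> ?A \<and> slope_mon (label E ?A) m = q r" using eq by (simp add: q_def)
        next
          assume eq: "msupp m \<subseteq> ?A \<and> slope_mon (label E ?A) m = q r"
          then have "msupp m = ?A" using msupp_slope_mon_cong(2) unfolding q_def by blast
          then show "q m = q r" using eq by (simp add: q_def)
        qed
        then show ?thesis by blast
      qed
      have "comp_map E ?A f = 0" using f supp[OF r] by (auto simp: comp_kernel_def)
      then have zero: "(\<Sum>m\<in>?C. lookup f m) = 0"
        unfolding C comp_map_def using lookup_slope[of ?A "label E ?A" f "q r"] by simp
      have "(\<Sum>m\<in>?C. single m (lookup f m))
          = (\<Sum>m\<in>?C. single 0 (lookup f m) * (single m 1 - single r 1)) + single r (\<Sum>m\<in>?C. lookup f m)"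
      proof -
        have "single r (\<Sum>m\<in>?C. lookup f m) = (\<Sum>m\<in>?C. single r (lookup f m))"
          by (rule poly_mapping_eqI) (simp add: lookup_sum lookup_single when_def)
        then show ?thesis
          by (simp add: right_diff_distrib mult_single sum_subtractf)
      qed
      also have "\<dots> = (\<Sum>m\<in>?C. single 0 (lookup f m) * (single m 1 - single r 1))"
        by (simp add: zero)
      also have "\<dots> \<in> edge_ideal"
      proof (rule edge_ideal_sum)
        fix m assume m: "m \<in> ?C"
        have "msupp m = ?A"
          using m msupp_slope_mon_cong(2) unfolding q_def by blast
        moreover have "slope_mon (label E ?A) m = slope_mon (label E ?A) r"
          using m calculation by (simp add: q_def)
        ultimately have "single m 1 - single r 1 \<in> (edge_ideal :: 'k poly set)"
          using supp[OF r] by (intro monomial_congruence)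
        then show "single 0 (lookup f m) * (single m 1 - single r 1) \<in> edge_ideal"
          by (intro edge_ideal_mult single_carrier) simp_all
      qed
      finally show ?thesis .
    qed
    have "f = (\<Sum>m\<in>keys f. single m (lookup f m))" by (simp add: sum_monomials)
    also have "\<dots> = (\<Sum>p\<in>q ` keys f. \<Sum>m | m \<in> keys f \<and> q m = p. single m (lookup f m))"
      by (rule sum.image_gen) simp
    also have "\<dots> \<in> edge_ideal"
      by (rule edge_ideal_sum) (use fibre_in in blast)
    finally show "f \<in> edge_ideal" .
  qed
qed

end

section \<open>Multigraded witnesses of associated primes\<close>

definition multihom :: "(nat \<Rightarrow> nat) \<Rightarrow> 'k::field poly \<Rightarrow> bool" where
  "multihom a f \<longleftrightarrow> (\<forall>m\<in>keys f. mdeg m = a)"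

definition multicomp :: "(nat \<Rightarrow> nat) \<Rightarrow> 'k::field poly \<Rightarrow> 'k poly" where
  "multicomp a f = (\<Sum>m | m \<in> keys f \<and> mdeg m = a. single m (lookup f m))"

lemma lookup_multicomp: "lookup (multicomp a f) m = (if mdeg m = a then lookup f m else 0)"
  by (auto simp: multicomp_def lookup_sum lookup_single when_def in_keys_iff)

lemma keys_multicomp: "keys (multicomp a f) = {m \<in> keys f. mdeg m = a}"
  by (auto simp: in_keys_iff lookup_multicomp split: if_splits)

lemma lookup_slope_multicomp:
  "lookup (slope A c (multicomp a f)) q =
     (if (\<lambda>i. lookup q (Y i)) = a then lookup (slope A c f) q else 0)"
proof (cases "(\<lambda>i. lookup q (Y i)) = a")
  case True
  have "{m. m \<in> keys (multicomp a f) \<and> msupp m \<subseteq> A \<and> slope_mon c m = q}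
      = {m. m \<in> keys f \<and> msupp m \<subseteq> A \<and> slope_mon c m = q}"
    using True by (auto simp: keys_multicomp lookup_slope_mon_Y)
  then show ?thesis
    using True by (auto simp: lookup_slope lookup_multicomp lookup_slope_mon_Y intro!: sum.cong)
next
  case False
  have "{m. m \<in> keys (multicomp a f) \<and> msupp m \<subseteq> A \<and> slope_mon c m = q} = {}"
    using False by (auto simp: keys_multicomp lookup_slope_mon_Y)
  then have "lookup (slope A c (multicomp a f)) q = 0"
    by (simp only: lookup_slope sum.empty)
  then show ?thesis using False by simp
qed

lemma slope_cong:
  assumes "\<And>m i. m \<in> keys f \<Longrightarrow> i \<in> msupp m \<Longrightarrow> c i = c' i"
  shows "slope A c f = slope A c' f"
proof -
  have "slope_mon c m = slope_mon c' m" if m: "m \<in> keys f" for m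
  proof -
    have "slope_var c v = slope_var c' v" if "v \<in> keys m" for v
      using that assms[OF m] by (cases v) (auto simp: msupp_eq_indices)
    then show ?thesis by (simp add: slope_mon_def)
  qed
  then show ?thesis unfolding slope_def by (intro sum.cong) auto
qed

text \<open>Degree one at the index \<open>i\<close> means that each monomial contains exactly one
  of \<open>x\<^sub>i\<close> and \<open>y\<^sub>i\<close>, once.\<close>

lemma split_linear_index:
  fixes f :: "'k::field poly"
  assumes "\<And>m. m \<in> keys f \<Longrightarrow> mdeg m i = 1"
  obtains F G where "f = indet (X i) * F + indet (Y i) * G"
    "\<And>m. m \<in> keys F \<Longrightarrow> i \<notin> msupp m" "\<And>m. m \<in> keys G \<Longrightarrow> i \<notin> msupp m"
proof -
  have "\<exists>F G. (\<Sum>m\<in>S. single m (lookup f m)) = indet (X i) * F + indet (Y i) * G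
      \<and> (\<forall>m\<in>keys F. i \<notin> msupp m) \<and> (\<forall>m\<in>keys G. i \<notin> msupp m)"
    if "finite S" "S \<subseteq> keys f" for S
    using that
  proof (induction S rule: finite_induct)
    case empty
    show ?case by (intro exI[of _ 0]) simp
  next
    case (insert m S)
    then obtain F G where FG: "(\<Sum>m\<in>S. single m (lookup f m)) = indet (X i) * F + indet (Y i) * G"
      "\<forall>m\<in>keys F. i \<notin> msupp m" "\<forall>m\<in>keys G. i \<notin> msupp m" by auto
    have sum: "(\<Sum>m\<in>insert m S. single m (lookup f m))
        = single m (lookup f m) + (indet (X i) * F + indet (Y i) * G)"
      using insert.hyps FG(1) by simp
    have deg: "lookup m (X i) + lookup m (Y i) = 1"
      using assms[of m] insert.prems by (simp add: mdeg_def)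
    define w where "w v = m - single v 1" for v
    have w: "single m (lookup f m) = indet v * single (w v) (lookup f m)" if "lookup m v = 1" for v
    proof -
      have "single v 1 + w v = m"
        unfolding w_def using that
        by (intro poly_mapping_eqI) (auto simp: lookup_add lookup_minus lookup_single when_def)
      then show ?thesis by (simp add: indet_def mult_single)
    qed
    consider "lookup m (X i) = 1" "lookup m (Y i) = 0" | "lookup m (X i) = 0" "lookup m (Y i) = 1"
      using deg by linarith
    then show ?case
    proof cases
      case 1
      have "i \<notin> msupp (w (X i))"
        using 1 by (simp add: w_def msupp_def mdeg_def lookup_minus lookup_single)
      then have "\<forall>l\<in>keys (single (w (X i)) (lookup f m) + F). i \<notin> msupp l"
        using FG(2) Poly_Mapping.keys_add[of "single (w (X i)) (lookup f m)" F]
        by (auto split: if_splits)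
      moreover have "(\<Sum>m\<in>insert m S. single m (lookup f m))
          = indet (X i) * (single (w (X i)) (lookup f m) + F) + indet (Y i) * G"
        unfolding sum w[OF 1(1)] by (simp add: algebra_simps)
      ultimately show ?thesis using FG(3) by blast
    next
      case 2
      have "i \<notin> msupp (w (Y i))"
        using 2 by (simp add: w_def msupp_def mdeg_def lookup_minus lookup_single)
      then have "\<forall>l\<in>keys (single (w (Y i)) (lookup f m) + G). i \<notin> msupp l"
        using FG(3) Poly_Mapping.keys_add[of "single (w (Y i)) (lookup f m)" G]
        by (auto split: if_splits)
      moreover have "(\<Sum>m\<in>insert m S. single m (lookup f m))
          = indet (X i) * F + indet (Y i) * (single (w (Y i)) (lookup f m) + G)"
        unfolding sum w[OF 2(2)] by (simp add: algebra_simps)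
      ultimately show ?thesis using FG(2) by blast
    qed
  qed
  from this[OF finite_keys subset_refl] show thesis
    unfolding sum_monomials using that by blast
qed

text \<open>As a function of the slope at \<open>i\<close>, the image of \<open>f = x\<^sub>i F +
  y\<^sub>i G\<close> is \<open>y\<^sub>i (t F' + G')\<close>, an affine function of
  \<open>t\<close>; two distinct zeros make it vanish identically.\<close>

lemma slope_linear_index:
  fixes f :: "'k::field poly"
  assumes deg: "\<And>m. m \<in> keys f \<Longrightarrow> mdeg m i = 1"
    and "p \<noteq> q" "slope A (c(i := p)) f = 0" "slope A (c(i := q)) f = 0"
  shows "slope A (c(i := r)) f = 0"
proof -
  obtain F G where f: "f = indet (X i) * F + indet (Y i) * G"
    and free: "\<And>m. m \<in> keys F \<Longrightarrow> i \<notin> msupp m" "\<And>m. m \<in> keys G \<Longrightarrow> i \<notin> msupp m"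
    using split_linear_index[OF deg] by metis
  have val: "slope A (c(i := s)) f
      = (if i \<in> A then indet (Y i) * (indet (X s) * slope A c F + slope A c G) else 0)" for s
  proof -
    have "slope A (c(i := s)) F = slope A c F" "slope A (c(i := s)) G = slope A c G"
      using free by (auto intro!: slope_cong)
    then show ?thesis
      unfolding f by (simp add: slope_add slope_mult slope_indet_X slope_indet_Y algebra_simps)
  qed
  show ?thesis
  proof (cases "i \<in> A")
    case True
    have 0: "indet (X p) * slope A c F + slope A c G = 0" "indet (X q) * slope A c F + slope A c G = 0"
      using assms(3,4) True by (simp_all add: val)
    have "(indet (X p) - indet (X q)) * slope A c F
        = (indet (X p) * slope A c F + slope A c G) - (indet (X q) * slope A c F + slope A c G)"
      by (simp add: algebra_simps)
    also have "\<dots> = 0" by (simp only: 0) simp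
    finally have "slope A c F = 0" using \<open>p \<noteq> q\<close> by simp
    then show ?thesis using 0(1) by (simp add: val)
  qed (simp add: val)
qed

text \<open>The kernel of the map of \<open>A\<close> contains \<open>x\<^sub>i\<close> for \<open>i
  \<notin> A\<close>, and \<open>[i,j]\<close> for linked \<open>i\<close> and \<open>j\<close>.
  Testing these elements turns an inclusion of kernels into combinatorics.\<close>

lemma comp_kernel_subsetD:
  assumes "comp_kernel n E A \<subseteq> (comp_kernel n E B :: 'k::field poly set)" "B \<subseteq> {1..n}"
  shows "B \<subseteq> A" "\<And>i j. i \<in> B \<Longrightarrow> j \<in> B \<Longrightarrow> linked E A i j \<Longrightarrow> linked E B i j"
proof -
  show "B \<subseteq> A"
  proof
    fix i assume i: "i \<in> B"
    show "i \<in> A"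
    proof (rule ccontr)
      assume "i \<notin> A"
      then have "indet (X i) \<in> (comp_kernel n E A :: 'k poly set)"
        using i assms(2) by (auto simp: comp_kernel_def comp_map_indet_eq_0_iff intro!: indet_carrier)
      then have "comp_map E B (indet (X i) :: 'k poly) = 0"
        using assms(1) by (auto simp: comp_kernel_def)
      then show False using i by (simp add: comp_map_indet_eq_0_iff)
    qed
  qed
  fix i j assume ij: "i \<in> B" "j \<in> B" "linked E A i j"
  then have "minor i j \<in> (comp_kernel n E A :: 'k poly set)"
    using assms(2) by (auto simp: comp_kernel_def comp_map_minor_eq_0_iff intro!: minor_carrier)
  then have "comp_map E B (minor i j :: 'k poly) = 0"
    using assms(1) by (auto simp: comp_kernel_def)
  then show "linked E B i j" using ij by (simp add: comp_map_minor_eq_0_iff)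
qed

lemma mon_degree_eq_sum_mdeg:
  assumes "msupp m \<subseteq> {1..n}"
  shows "mon_degree m = (\<Sum>i\<in>{1..n}. mdeg m i)"
proof -
  let ?S = "X ` {1..n} \<union> Y ` {1..n}"
  have "v \<in> ?S" if "v \<in> keys m" for v
    using that assms by (cases v) (auto simp: msupp_eq_indices)
  then have "mon_degree m = (\<Sum>v\<in>?S. lookup m v)"
    unfolding mon_degree_def by (intro sum.mono_neutral_left) (auto simp: in_keys_iff)
  also have "\<dots> = (\<Sum>v\<in>X ` {1..n}. lookup m v) + (\<Sum>v\<in>Y ` {1..n}. lookup m v)"
    by (rule sum.union_disjoint) auto
  also have "\<dots> = (\<Sum>i\<in>{1..n}. lookup m (X i)) + (\<Sum>i\<in>{1..n}. lookup m (Y i))"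
    by (simp add: sum.reindex inj_on_def)
  finally show ?thesis by (simp add: mdeg_def sum.distrib)
qed

context graph_on
begin

text \<open>Since \<open>J : f\<close> is the intersection of the kernels of the component maps that
  do not kill \<open>f\<close>, it equals the kernel for \<open>A\<close> exactly when that one
  occurs and is contained in all others that occur.\<close>

definition isolates :: "nat set \<Rightarrow> 'k::field poly \<Rightarrow> bool" where
  "isolates A f \<longleftrightarrow> A \<subseteq> {1..n} \<and> f \<in> carrier (poly_ring n) \<and> comp_map E A f \<noteq> 0 \<and>
     (\<forall>B\<subseteq>{1..n}. comp_map E B f \<noteq> 0 \<longrightarrow> comp_kernel n E A \<subseteq> (comp_kernel n E B :: 'k poly set))"

lemma in_colon_edge_ideal_iff:
  assumes "f \<in> carrier (poly_ring n)"
  shows "g \<in> colon n edge_ideal f \<longleftrightarrow> g \<in> carrier (poly_ring n) \<and>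
    (\<forall>B\<subseteq>{1..n}. comp_map E B f \<noteq> 0 \<longrightarrow> comp_map E B (g :: 'k::field poly) = 0)"
proof -
  have "g * f \<in> (edge_ideal :: 'k poly set) \<longleftrightarrow>
      (\<forall>B\<subseteq>{1..n}. comp_map E B f \<noteq> 0 \<longrightarrow> comp_map E B g = 0)" if "g \<in> carrier (poly_ring n)"
    using that assms mult_carrier[of g n f]
    by (auto simp: edge_ideal_eq_Inter_kernels comp_kernel_def comp_map_def slope_mult)
  then show ?thesis by (auto simp: colon_def)
qed

lemma isolates_colon:
  assumes "isolates A (f :: 'k::field poly)"
  shows "colon n edge_ideal f = comp_kernel n E A"
proof (rule Set.set_eqI)
  fix g
  show "g \<in> colon n edge_ideal f \<longleftrightarrow> g \<in> comp_kernel n E A"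
    using assms unfolding isolates_def by (subst in_colon_edge_ideal_iff) (auto simp: comp_kernel_def)
qed

text \<open>A prime ideal that is an intersection of finitely many ideals is one of them: otherwise
  the product of elements of these ideals that avoid the prime would lie in the
  intersection.\<close>

lemma prime_colon_isolates:
  assumes f: "f \<in> carrier (poly_ring n)"
    and prime: "primeideal (colon n edge_ideal (f :: 'k::field poly)) (poly_ring n)"
  obtains A where "isolates A f"
proof -
  let ?P = "colon n edge_ideal f" and ?S = "{B. B \<subseteq> {1..n} \<and> comp_map E B f \<noteq> 0}"
  have "\<exists>A\<in>?S. comp_kernel n E A \<subseteq> ?P"
  proof (rule ccontr)
    assume "\<not> ?thesis"
    then have ex: "\<forall>B\<in>?S. \<exists>g. g \<in> comp_kernel n E B \<and> g \<notin> ?P" by blast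
    obtain g where "\<forall>B\<in>?S. g B \<in> comp_kernel n E B \<and> g B \<notin> ?P"
      using bchoice[OF ex] by (rule exE)
    then have g: "\<And>B. B \<in> ?S \<Longrightarrow> g B \<in> comp_kernel n E B \<and> g B \<notin> ?P"
      by blast
    have avoid: "finite T \<Longrightarrow> T \<subseteq> ?S \<Longrightarrow>
      (\<Prod>B\<in>T. g B) \<in> carrier (poly_ring n) \<and> (\<Prod>B\<in>T. g B) \<notin> ?P" for T
    proof (induction T rule: finite_induct)
      case empty
      show ?case
        using ideal.one_imp_carrier[OF primeideal.axioms(1)[OF prime]] primeideal.I_notcarr[OF prime]
        by auto
    next
      case (insert B T)
      have "g B \<in> carrier (poly_ring n)" "g B \<notin> ?P"
        using g insert.prems by (auto simp: comp_kernel_def)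
      moreover have "(\<Prod>B\<in>T. g B) \<in> carrier (poly_ring n)" "(\<Prod>B\<in>T. g B) \<notin> ?P"
        using insert by auto
      ultimately show ?case
        using primeideal.I_prime[OF prime, of "g B" "\<Prod>B\<in>T. g B"] insert.hyps
        by (auto simp: mult_carrier)
    qed
    have "finite ?S" by (rule finite_subset[of _ "Pow {1..n}"]) auto
    have "comp_map E B (\<Prod>B\<in>?S. g B) = 0" if "B \<in> ?S" for B
      using g[OF that] that \<open>finite ?S\<close>
      by (auto simp: comp_map_def comp_kernel_def slope_prod prod_zero_iff intro!: bexI[of _ B])
    then have "(\<Prod>B\<in>?S. g B) \<in> ?P"
      using avoid[OF \<open>finite ?S\<close>] by (simp add: in_colon_edge_ideal_iff[OF f])
    then show False using avoid[OF \<open>finite ?S\<close>] by blast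
  qed
  then obtain A where A: "A \<in> ?S" "comp_kernel n E A \<subseteq> ?P" by blast
  have "?P \<subseteq> comp_kernel n E B" if "B \<in> ?S" for B
    using that by (auto simp: in_colon_edge_ideal_iff[OF f] comp_kernel_def)
  then have "isolates A f" using A f unfolding isolates_def by blast
  then show thesis by (rule that)
qed

text \<open>Component maps respect the multigrading, so a component of \<open>f\<close> survives
  under the map of \<open>A\<close>, and every map that kills \<open>f\<close> kills this component
  too.\<close>

lemma isolates_multicomp:
  assumes "isolates A (f :: 'k::field poly)"
  obtains a where "isolates A (multicomp a f)"
proof -
  have "comp_map E A f \<noteq> 0" using assms by (simp add: isolates_def)
  then obtain q where q: "lookup (comp_map E A f) q \<noteq> 0"
    by (metis poly_mapping_eqI lookup_zero)
  let ?a = "\<lambda>i. lookup q (Y i)"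
  have "comp_map E A (multicomp ?a f) \<noteq> 0"
    using q lookup_slope_multicomp[of A "label E A" ?a f q] by (auto simp: comp_map_def)
  moreover have "comp_map E B (multicomp ?a f) = 0" if "comp_map E B f = 0" for B
    using that by (intro poly_mapping_eqI) (simp add: comp_map_def lookup_slope_multicomp)
  moreover have "multicomp ?a f \<in> carrier (poly_ring n)"
    using assms by (auto simp: isolates_def carrier_poly_ring keys_multicomp)
  ultimately have "isolates A (multicomp ?a f)"
    using assms unfolding isolates_def by blast
  then show thesis by (rule that)
qed

lemma isolates_nonzero: "isolates A f \<Longrightarrow> f \<noteq> 0"
  by (auto simp: isolates_def comp_map_def)

lemma multihom_graded_part:
  assumes "multihom a f" "f \<in> carrier (poly_ring n)"
  shows "f \<in> graded_part n (\<Sum>i\<in>{1..n}. a i)"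
  using assms by (auto simp: graded_part_def multihom_def carrier_poly_ring mon_degree_eq_sum_mdeg)

lemma isolates_in_Ass:
  "isolates A (f :: 'k::field poly) \<Longrightarrow> comp_kernel n E A \<in> Ass n (edge_ideal :: 'k poly set)"
  using isolates_colon[of A f] primeideal_comp_kernel by (auto simp: Ass_def isolates_def)

text \<open>Multihomogeneous witnesses serve twice. A witness of an associated prime is arbitrary,
  and its surviving component shows that the minimum in the local \<open>v\<close>-number is over a
  nonempty set. A witness that attains the minimum has a surviving component of the same degree, to
  which the lower bound applies.\<close>

lemma v_number_edge_ideal_eqI:
  assumes f: "isolates A (f :: 'k::field poly)" "f \<in> graded_part n d"
    and lower: "\<And>a A (g :: 'k poly). multihom a g \<Longrightarrow> isolates A g \<Longrightarrow> d \<le> (\<Sum>i\<in>{1..n}. a i)"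
  shows "v_number n (edge_ideal :: 'k poly set) = d"
proof -
  let ?J = "edge_ideal :: 'k poly set"
  have mem: "comp_kernel n E A \<in> Ass n ?J" using f(1) by (rule isolates_in_Ass)
  have upper: "local_v_number n ?J (comp_kernel n E A) \<le> d"
    unfolding local_v_number_def using f isolates_colon by (intro Least_le) blast
  have low: "d \<le> local_v_number n ?J P" if P: "P \<in> Ass n ?J" for P
  proof -
    let ?w = "\<lambda>d. \<exists>f\<in>graded_part n d. colon n ?J f = P"
    obtain g where g: "g \<in> carrier (poly_ring n)" "colon n ?J g = P" "primeideal P (poly_ring n)"
      using P by (auto simp: Ass_def)
    obtain B where B: "isolates B g" using prime_colon_isolates[of g] g by blast
    obtain a where a: "isolates B (multicomp a g)" using isolates_multicomp[OF B] .
    have "multicomp a g \<in> graded_part n (\<Sum>i\<in>{1..n}. a i)"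
      using a by (intro multihom_graded_part) (auto simp: multihom_def keys_multicomp isolates_def)
    moreover have "colon n ?J (multicomp a g) = P"
      using isolates_colon[OF a] isolates_colon[OF B] g by simp
    \<comment> \<open>this makes the \<open>LEAST\<close> in the local number attained\<close>
    ultimately have "?w (\<Sum>i\<in>{1..n}. a i)" by blast
    then have "?w (local_v_number n ?J P)"
      unfolding local_v_number_def by (rule LeastI)
    then obtain h where h: "h \<in> graded_part n (local_v_number n ?J P)" "colon n ?J h = P" by blast
    then have "h \<in> carrier (poly_ring n)" by (simp add: graded_part_def)
    then obtain C where C: "isolates C h" using prime_colon_isolates[of h] h g by blast
    obtain b where b: "isolates C (multicomp b h)" using isolates_multicomp[OF C] .
    obtain m where m: "m \<in> keys h" "mdeg m = b"
      using isolates_nonzero[OF b] keys_multicomp[of b h] keys_eq_empty[of "multicomp b h"] by blast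
    have "local_v_number n ?J P = (\<Sum>i\<in>{1..n}. b i)"
      using m h(1) mon_degree_eq_sum_mdeg[of m n] by (auto simp: graded_part_def carrier_poly_ring)
    moreover have "d \<le> (\<Sum>i\<in>{1..n}. b i)"
      using b by (intro lower) (auto simp: multihom_def keys_multicomp)
    ultimately show ?thesis by simp
  qed
  show ?thesis
    unfolding v_number_def
  proof (rule antisym)
    show "(INF P\<in>Ass n ?J. local_v_number n ?J P) \<le> d"
      using cINF_lower[OF _ mem, of "local_v_number n ?J"] upper by (simp add: order_trans)
    show "d \<le> (INF P\<in>Ass n ?J. local_v_number n ?J P)"
      using mem low by (intro cINF_greatest) auto
  qed
qed

end

text \<open>Inside this locale \<open>D\<close> is the set of vertices that occur in the witness
  \<open>f\<close>. The arguments replace \<open>A\<close> by another vertex set \<open>B\<close>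
  that contains \<open>D\<close>: if \<open>B\<close> links no more vertices of \<open>D\<close>
  than \<open>A\<close> does, then \<open>f\<close> survives under the map of \<open>B\<close>, and
  isolation makes the kernel for \<open>B\<close> contain that for \<open>A\<close>.\<close>

locale isolating_multihom = graph_on n E for n E +
  fixes A :: "nat set" and f :: "'k::field poly" and a :: "nat \<Rightarrow> nat"
  assumes hom: "multihom a f" and iso: "isolates A f"
begin

definition D :: "nat set" where
  "D = {i. a i \<noteq> 0}"

lemma msupp_key: "m \<in> keys f \<Longrightarrow> msupp m = D"
  using hom by (auto simp: multihom_def msupp_def D_def)

lemma D_subset: "D \<subseteq> A"
proof (rule ccontr)
  assume "\<not> D \<subseteq> A"
  then have "comp_map E A f = 0" by (simp add: comp_map_def slope_def msupp_key)
  then show False using iso by (simp add: isolates_def)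
qed

lemma A_subset: "A \<subseteq> {1..n}"
  using iso by (simp add: isolates_def)

lemma finite_D: "finite D"
  using finite_subset[OF subset_trans[OF D_subset A_subset]] by simp

lemma comp_map_coarsen:
  assumes "D \<subseteq> B" "D \<subseteq> B'" "comp_map E B f = 0"
    and "\<And>i j. i \<in> D \<Longrightarrow> j \<in> D \<Longrightarrow> linked E B i j \<Longrightarrow> linked E B' i j"
  shows "comp_map E B' f = 0"
  using assms finite_D msupp_key unfolding comp_map_def
  by (intro slope_eq_0_coarsen[of D f B B' "label E B" "label E B'"]) (auto simp: label_eq_iff)

lemma comp_map_zero: "B \<subseteq> {1..n} \<Longrightarrow> \<not> B \<subseteq> A \<Longrightarrow> comp_map E B f = 0"
  using iso comp_kernel_subsetD(1)[of n E A B] unfolding isolates_def by blast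

text \<open>Deleting vertices that do not occur in \<open>f\<close> cannot disconnect the rest:
  \<open>f\<close> survives the deletion, but the kernel would lose the minors of the disconnected
  pairs.\<close>

lemma linked_between:
  assumes "D \<subseteq> B" "B \<subseteq> A" "i \<in> B" "j \<in> B" "linked E A i j"
  shows "linked E B i j"
proof -
  have "comp_map E B f \<noteq> 0"
    using comp_map_coarsen[of B A] D_subset assms(1,2) linked_mono iso by (auto simp: isolates_def)
  then have "comp_kernel n E A \<subseteq> (comp_kernel n E B :: 'k poly set)" "B \<subseteq> {1..n}"
    using iso assms(2) unfolding isolates_def by blast+
  then show ?thesis using assms comp_kernel_subsetD(2) by blast
qed

text \<open>If adding \<open>p\<close> to \<open>D\<close> joined no components, \<open>f\<close>
  would survive under the map of a set that is not contained in \<open>A\<close>.\<close>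

lemma outside_separates:
  assumes "p \<in> {1..n}" "p \<notin> A"
  obtains u v where "u \<in> D" "v \<in> D" "{u, p} \<in> E" "{v, p} \<in> E" "\<not> linked E D u v"
proof (rule ccontr)
  assume "\<not> thesis"
  then have nbrs: "\<And>u v. u \<in> D \<Longrightarrow> v \<in> D \<Longrightarrow> {u, p} \<in> E \<Longrightarrow> {v, p} \<in> E \<Longrightarrow> linked E D u v"
    using that by blast
  have "insert p D \<subseteq> {1..n}" using assms D_subset A_subset by blast
  then have "comp_map E (insert p D) f = 0"
    using assms by (intro comp_map_zero) auto
  then have "comp_map E A f = 0"
  proof (rule comp_map_coarsen[rotated 2])
    fix i j assume ij: "i \<in> D" "j \<in> D" "linked E (insert p D) i j"
    show "linked E A i j"
      using linked_insert[OF ij(3,1,2) nbrs] D_subset by (rule linked_mono)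
  qed (use D_subset in auto)
  then show False using iso by (simp add: isolates_def)
qed

text \<open>Suppose that \<open>f\<close> has degree one at an isolated vertex \<open>i\<close>.
  Adding \<open>p\<close> glues \<open>i\<close> to the component of \<open>q\<close>, and adding
  \<open>p'\<close> glues it to that of \<open>r\<close>; both maps kill \<open>f\<close>. Were
  these components different, \<open>f\<close> would vanish for two different slopes at
  \<open>i\<close>, hence for every slope, and so under the map of \<open>A\<close>.\<close>

lemma no_linear_isolated_bridge:
  assumes "D = A" "i \<in> D" "a i = 1" "\<And>u. u \<in> D \<Longrightarrow> {i, u} \<notin> E"
    and p: "p \<in> {1..n}" "p \<notin> D" "q \<in> D" "\<And>u. u \<in> D \<Longrightarrow> {u, p} \<in> E \<Longrightarrow> u \<noteq> i \<Longrightarrow> linked E D u q"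
    and p': "p' \<in> {1..n}" "p' \<notin> D" "r \<in> D" "\<And>u. u \<in> D \<Longrightarrow> {u, p'} \<in> E \<Longrightarrow> u \<noteq> i \<Longrightarrow> linked E D u r"
  shows "linked E D q r"
proof (rule ccontr)
  let ?c = "label E D"
  assume "\<not> linked E D q r"
  then have "?c q \<noteq> ?c r" by (simp add: label_eq_iff)
  have glue: "slope D (?c(i := ?c q)) f = 0"
    if p: "p \<in> {1..n}" "p \<notin> D" "q \<in> D" "\<And>u. u \<in> D \<Longrightarrow> {u, p} \<in> E \<Longrightarrow> u \<noteq> i \<Longrightarrow> linked E D u q" for p q
  proof (rule slope_eq_0_coarsen[of D f "insert p D" D "label E (insert p D)"])
    show "slope (insert p D) (label E (insert p D)) f = 0"
      using p(1,2) assms(1) A_subset comp_map_zero[of "insert p D"] by (simp add: comp_map_def)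
  next
    fix u v assume uv: "u \<in> D" "v \<in> D" "label E (insert p D) u = label E (insert p D) v"
    \<comment> \<open>with the value \<open>?c q\<close> at the new vertex, the labelling is constant along all edges\<close>
    let ?g = "?c(i := ?c q, p := ?c q)"
    have "?g u = ?g v"
    proof (rule linked_invariant[where E = E and A = "insert p D" and g = ?g])
      show "linked E (insert p D) u v" using uv(3) by (simp add: label_eq_iff)
      fix x y assume xy: "x \<in> insert p D" "y \<in> insert p D" "{x, y} \<in> E"
      have glued: "?g z = ?c q" if "z \<in> D" "{z, p} \<in> E" for z
        using p(4)[OF that] p(2) that by (auto simp: label_eq_iff)
      have inside: "?g z = ?c z" if "z \<in> D" "z \<noteq> i" for z
        using that p(2) by auto
      show "?g x = ?g y"
      proof (cases "x = p \<or> y = p")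
        case True
        then show ?thesis
          using glued[of x] glued[of y] xy by (auto simp: insert_commute)
      next
        case False
        then have "x \<in> D" "y \<in> D" using xy by auto
        moreover have "x \<noteq> i" "y \<noteq> i"
          using assms(4)[of x] assms(4)[of y] xy(3) \<open>x \<in> D\<close> \<open>y \<in> D\<close> by (auto simp: insert_commute)
        ultimately show ?thesis
          using inside linked_edge[of x D y E] xy(3) by (simp add: label_eq_iff)
      qed
    qed
    then show "(?c(i := ?c q)) u = (?c(i := ?c q)) v" using uv p(2) by (auto split: if_splits)
  qed (use finite_D msupp_key in auto)
  have deg: "mdeg m i = 1" if "m \<in> keys f" for m
    using that hom assms(3) by (simp add: multihom_def)
  have "slope D (?c(i := ?c i)) f = 0"
    using slope_linear_index[OF deg \<open>?c q \<noteq> ?c r\<close> glue[OF p] glue[OF p']] .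
  then show False using iso assms(1) by (simp add: isolates_def comp_map_def)
qed

end

section \<open>The lower bound for cycles\<close>

definition nxt :: "nat \<Rightarrow> nat \<Rightarrow> nat" where
  "nxt n i = (if i = n then 1 else i + 1)"

definition prv :: "nat \<Rightarrow> nat \<Rightarrow> nat" where
  "prv n i = (if i = 1 then n else i - 1)"

lemma nxt_prv:
  assumes "i \<in> {1..n}"
  shows "nxt n i \<in> {1..n}" "prv n i \<in> {1..n}" "nxt n (prv n i) = i" "prv n (nxt n i) = i"
  using assms by (auto simp: nxt_def prv_def)

lemma nxt_prv_distinct:
  assumes "n \<ge> 3" "i \<in> {1..n}"
  shows "nxt n i \<noteq> i" "prv n i \<noteq> i" "nxt n i \<noteq> prv n i"
  using assms by (auto simp: nxt_def prv_def split: if_splits)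

lemma cycle_graph_iff:
  assumes "n \<ge> 3"
  shows "{i, j} \<in> cycle_graph n \<longleftrightarrow> i \<in> {1..n} \<and> (j = nxt n i \<or> j = prv n i)"
proof -
  have "{i, j} \<in> cycle_graph n \<longleftrightarrow> 1 \<le> i \<and> i < n \<and> j = i + 1 \<or> 1 \<le> j \<and> j < n \<and> i = j + 1
      \<or> i = n \<and> j = 1 \<or> i = 1 \<and> j = n"
    unfolding cycle_graph_def by (auto simp: doubleton_eq_iff)
  also have "\<dots> \<longleftrightarrow> i \<in> {1..n} \<and> (j = nxt n i \<or> j = prv n i)"
    unfolding nxt_def prv_def atLeastAtMost_iff using assms
    by (cases "i = n"; cases "i = 1"; simp; arith)
  finally show ?thesis .
qed

lemma sum_window:
  assumes "n \<ge> 1"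
  shows "(\<Sum>i\<in>{1..n}. a (prv n i) + a i + a (nxt n i)) = 3 * (\<Sum>i\<in>{1..n}. (a i :: nat))"
proof -
  have "bij_betw (nxt n) {1..n} {1..n}"
    by (rule bij_betw_byWitness[where f' = "prv n"]) (use nxt_prv in auto)
  moreover have "bij_betw (prv n) {1..n} {1..n}"
    by (rule bij_betw_byWitness[where f' = "nxt n"]) (use nxt_prv in auto)
  ultimately show ?thesis
    using sum.reindex_bij_betw[of "nxt n" _ _ a] sum.reindex_bij_betw[of "prv n" _ _ a]
    by (simp add: sum.distrib)
qed

lemma graph_on_cycle: "n \<ge> 3 \<Longrightarrow> graph_on n (cycle_graph n)"
  by unfold_locales (simp add: cycle_graph_iff)

text \<open>Two missing vertices cut the cycle into two arcs. One of them is the interval between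
  the two numbers; the other consists of everything else and passes through the edge from
  \<open>n\<close> to \<open>1\<close>.\<close>

lemma linked_cycle_cut:
  assumes "n \<ge> 3" "j \<in> {1..n}" "p \<in> {1..n}" "j \<notin> B" "p \<notin> B" "linked (cycle_graph n) B i k"
  shows "i \<in> {min j p<..<max j p} \<longleftrightarrow> k \<in> {min j p<..<max j p}"
proof (rule linked_invariant[OF assms(6)])
  fix u v assume "u \<in> B" "v \<in> B" "{u, v} \<in> cycle_graph n"
  then have "u \<noteq> j" "u \<noteq> p" "v \<noteq> j" "v \<noteq> p" "u \<in> {1..n}" "v = nxt n u \<or> v = prv n u"
    using assms(1,4,5) by (auto simp: cycle_graph_iff)
  then show "u \<in> {min j p<..<max j p} \<longleftrightarrow> v \<in> {min j p<..<max j p}"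
    using assms(2,3) by (auto simp: nxt_def prv_def min_def max_def split: if_splits)
qed

lemma linked_whole_cycle:
  assumes "n \<ge> 3" "i \<in> {1..n}" "j \<in> {1..n}"
  shows "linked (cycle_graph n) {1..n} i j"
proof -
  have from_1: "linked (cycle_graph n) {1..n} 1 k" if "1 \<le> k" "k \<le> n" for k
    using that
  proof (induction k rule: dec_induct)
    case (step k)
    then have "linked (cycle_graph n) {1..n} k (Suc k)"
      using assms(1) by (intro linked_edge) (auto simp: cycle_graph_iff nxt_def)
    then show ?case using step by (auto intro: linked_trans)
  qed simp
  then show ?thesis
    using linked_trans[OF linked_sym[OF from_1[of i]] from_1[of j]] assms by simp
qed

text \<open>The vertices at distance two from \<open>i\<close> lie in different arcs of the cycle
  cut at \<open>x\<close> and at the successor of \<open>i\<close>.\<close>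

lemma second_neighbours_separated:
  assumes "n \<ge> 4" "i \<in> {1..n}" "x \<in> {1..n}" "x \<noteq> i" "x \<noteq> nxt n i" "x \<noteq> prv n i"
    "x \<noteq> nxt n (nxt n i)" "x \<noteq> prv n (prv n i)"
  shows "nxt n (nxt n i) \<in> {min (nxt n i) x<..<max (nxt n i) x} \<longleftrightarrow>
    prv n (prv n i) \<notin> {min (nxt n i) x<..<max (nxt n i) x}"
proof -
  have x: "1 \<le> x" "x \<le> n" using assms by auto
  consider "i = 1" | "i = 2" | "3 \<le> i" "i \<le> n - 2" | "i = n - 1" "3 \<le> i" | "i = n" "3 \<le> i"
    using assms(1,2) by force
  then show ?thesis
  proof cases
    case 1
    then have "nxt n i = 2" "nxt n (nxt n i) = 3" "prv n i = n" "prv n (prv n i) = n - 1"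
      using assms(1) by (auto simp: nxt_def prv_def)
    then show ?thesis using assms(1,4-8) x 1 by (auto simp: min_def max_def)
  next
    case 2
    then have "nxt n i = 3" "nxt n (nxt n i) = 4" "prv n i = 1" "prv n (prv n i) = n"
      using assms(1) by (auto simp: nxt_def prv_def)
    then show ?thesis using assms(1,4-8) x 2 by (auto simp: min_def max_def)
  next
    case 3
    then have "nxt n i = i + 1" "nxt n (nxt n i) = i + 2" "prv n i = i - 1" "prv n (prv n i) = i - 2"
      using assms(1) by (auto simp: nxt_def prv_def)
    then show ?thesis using assms(1,4-8) x 3 by (auto simp: min_def max_def)
  next
    case 4
    then have "nxt n i = n" "nxt n (nxt n i) = 1" "prv n i = n - 2" "prv n (prv n i) = n - 3"
      using assms(1) by (auto simp: nxt_def prv_def)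
    moreover from this have "x = n \<or> x = i \<or> x < n - 3" using assms(4-8) x 4 by arith
    ultimately show ?thesis using assms(1,4-8) x 4 by (auto simp: min_def max_def)
  next
    case 5
    then have "nxt n i = 1" "nxt n (nxt n i) = 2" "prv n i = n - 1" "prv n (prv n i) = n - 2"
      using assms(1) by (auto simp: nxt_def prv_def)
    then show ?thesis using assms(1,4-8) x 5 by (auto simp: min_def max_def)
  qed
qed

locale isolating_cycle = isolating_multihom n "cycle_graph n" A f a
  for n A and f :: "'k::field poly" and a +
  assumes n_ge: "n \<ge> 4"
begin

lemma outside_neighbours:
  assumes "p \<in> {1..n}" "p \<notin> A"
  shows "prv n p \<in> D" "nxt n p \<in> D" "\<not> linked (cycle_graph n) D (prv n p) (nxt n p)"
proof -
  obtain u v where uv: "u \<in> D" "v \<in> D" "{u, p} \<in> cycle_graph n" "{v, p} \<in> cycle_graph n"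
    "\<not> linked (cycle_graph n) D u v"
    using outside_separates[OF assms] .
  have "u \<noteq> v" using uv(5) by auto
  moreover have "u = nxt n p \<or> u = prv n p" "v = nxt n p \<or> v = prv n p"
    using uv(3,4) n_ge cycle_graph_iff[of n p u] cycle_graph_iff[of n p v]
    by (auto simp: insert_commute)
  ultimately have "u = prv n p \<and> v = nxt n p \<or> u = nxt n p \<and> v = prv n p" by auto
  then show "prv n p \<in> D" "nxt n p \<in> D" "\<not> linked (cycle_graph n) D (prv n p) (nxt n p)"
    using uv linked_sym by auto
qed

text \<open>A vertex \<open>j \<in> A - D\<close> has both neighbours in \<open>A\<close>: a
  neighbour outside of \<open>A\<close> would need \<open>j \<in> D\<close>. Then deleting
  \<open>j\<close> separates these neighbours, since another vertex is missing from \<open>A\<close>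
  as well, and this contradicts \<open>linked_between\<close>.\<close>

lemma A_eq_D:
  assumes "A \<noteq> {1..n}"
  shows "A = D"
proof (rule ccontr)
  assume "A \<noteq> D"
  then obtain j where j: "j \<in> A" "j \<notin> D" using D_subset by blast
  obtain p where p: "p \<in> {1..n}" "p \<notin> A" using assms A_subset by blast
  have j1: "j \<in> {1..n}" using j A_subset by blast
  have n3: "n \<ge> 3" using n_ge by simp
  have nb: "prv n j \<in> A" "nxt n j \<in> A"
    using outside_neighbours[of "prv n j"] outside_neighbours[of "nxt n j"] nxt_prv[OF j1] j by auto
  have "linked (cycle_graph n) A (prv n j) j" "linked (cycle_graph n) A j (nxt n j)"
    using nb j j1 nxt_prv[OF j1] n3 by (auto intro!: linked_edge simp: cycle_graph_iff)
  then have "linked (cycle_graph n) A (prv n j) (nxt n j)" by (rule linked_trans)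
  moreover have "D \<subseteq> A - {j}" "A - {j} \<subseteq> A" using D_subset j by blast+
  moreover have "prv n j \<in> A - {j}" "nxt n j \<in> A - {j}"
    using nb nxt_prv_distinct[OF n3 j1] by simp_all
  ultimately have "linked (cycle_graph n) (A - {j}) (prv n j) (nxt n j)"
    by (rule linked_between[rotated 4])
  then have "prv n j \<in> {min j p<..<max j p} \<longleftrightarrow> nxt n j \<in> {min j p<..<max j p}"
    using p by (intro linked_cycle_cut[OF n3 j1]) auto
  moreover have "p \<noteq> j" "p \<noteq> prv n j" "p \<noteq> nxt n j" using p j nb by auto
  ultimately show False
    using j1 p n3 by (auto simp: nxt_def prv_def min_def max_def split: if_splits)
qed

text \<open>Here the prime is the ideal of all \<open>2 \<times> 2\<close> minors. Deleting two
  nonadjacent vertices disconnects the cycle, so any two vertices missing from \<open>D\<close> are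
  adjacent, and a cycle with at least four vertices has no triangle.\<close>

lemma card_D_whole:
  assumes "A = {1..n}"
  shows "n - 2 \<le> card D"
proof -
  have n3: "n \<ge> 3" using n_ge by simp
  have adj: "k = j + 1 \<or> j = 1 \<and> k = n" if jk: "j \<in> {1..n} - D" "k \<in> {1..n} - D" "j < k" for j k
  proof (rule ccontr)
    assume no: "\<not> ?thesis"
    define x where "x = j + 1"
    \<comment> \<open>\<open>x\<close> lies in the arc between \<open>j\<close> and \<open>k\<close>, and \<open>y\<close> in the other one\<close>
    define y where "y = (if j = 1 then k + 1 else j - 1)"
    have xy: "x \<in> {1..n} - {j, k}" "y \<in> {1..n} - {j, k}"
      using no jk by (auto simp: x_def y_def)
    have "linked (cycle_graph n) A x y"
      using xy linked_whole_cycle[OF n3, of x y] assms by simp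
    moreover have "D \<subseteq> {1..n} - {j, k}" "{1..n} - {j, k} \<subseteq> A" using D_subset jk assms by blast+
    ultimately have "linked (cycle_graph n) ({1..n} - {j, k}) x y"
      using xy by (rule linked_between[rotated 4])
    then have "x \<in> {min j k<..<max j k} \<longleftrightarrow> y \<in> {min j k<..<max j k}"
      using jk by (intro linked_cycle_cut[OF n3]) auto
    then show False using no jk by (auto simp: x_def y_def split: if_splits)
  qed
  have "card ({1..n} - D) \<le> 2"
  proof (cases "{1..n} - D = {}")
    case True
    then show ?thesis by (metis card.empty zero_le)
  next
    case False
    define j where "j = Min ({1..n} - D)"
    have j: "j \<in> {1..n} - D" "\<And>k. k \<in> {1..n} - D \<Longrightarrow> j \<le> k"
      using Min_in[OF _ False] Min_le[of "{1..n} - D"] by (auto simp: j_def)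
    have near: "k = j \<or> k = j + 1 \<or> j = 1 \<and> k = n" if "k \<in> {1..n} - D" for k
      using adj[OF j(1) that] j(2)[OF that] by linarith
    have "{1..n} - D \<subseteq> {j, j + 1} \<or> {1..n} - D \<subseteq> {j, n}"
    proof (rule ccontr)
      assume no: "\<not> ?thesis"
      then obtain k l where kl: "k \<in> {1..n} - D" "k \<notin> {j, j + 1}" "l \<in> {1..n} - D" "l \<notin> {j, n}"
        by blast
      then have "j = 1" "k = n" "l = 2" using near[of k] near[of l] by auto
      then show False using adj[of l k] kl n_ge by auto
    qed
    moreover have "card {j, j + 1} \<le> 2" "card {j, n} \<le> 2" by (auto simp: card_insert_if)
    ultimately show ?thesis
      using card_mono[of "{j, j + 1}" "{1..n} - D"] card_mono[of "{j, n}" "{1..n} - D"] by fastforce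
  qed
  moreover have "card ({1..n} - D) = n - card D"
    using D_subset assms finite_D by (simp add: card_Diff_subset)
  ultimately show ?thesis by linarith
qed

text \<open>Missing vertices have both neighbours in \<open>D\<close>, so the only possible window
  of smaller degree is \<open>0, 1, 0\<close>. Its middle vertex is isolated in \<open>D\<close>,
  and \<open>no_linear_isolated_bridge\<close> then links the two vertices at distance two. On a
  cycle this leaves no room for a third missing vertex.\<close>

lemma window_ge_2:
  assumes AD: "A = D" and i: "i \<in> {1..n}"
  shows "2 \<le> a (prv n i) + a i + a (nxt n i) \<or> n - 2 \<le> card D"
proof (rule ccontr)
  assume no: "\<not> ?thesis"
  let ?E = "cycle_graph n"
  let ?p = "nxt n i" and ?p' = "prv n i"
  have n3: "n \<ge> 3" using n_ge by simp
  have mem: "j \<in> D \<longleftrightarrow> a j \<noteq> 0" for j by (simp add: D_def)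
  have iD: "i \<in> D"
  proof (rule ccontr)
    assume "i \<notin> D"
    then show False using outside_neighbours[of i] AD i mem no by auto
  qed
  have zero: "?p \<notin> D" "?p' \<notin> D" and one: "a i = 1"
    using no iD mem by auto
  have p: "?p \<in> {1..n}" "?p' \<in> {1..n}" and inv: "prv n ?p = i" "nxt n ?p' = i"
    using nxt_prv[OF i] by auto
  let ?q = "nxt n ?p" and ?r = "prv n ?p'"
  have q: "?q \<in> D" and r: "?r \<in> D"
    using outside_neighbours[OF p(1)] outside_neighbours[OF p(2)] AD zero by auto
  have "linked ?E D ?q ?r"
  proof (rule no_linear_isolated_bridge[of i ?p ?q ?p' ?r])
    show "{i, u} \<notin> ?E" if "u \<in> D" for u
      using that zero n3 by (auto simp: cycle_graph_iff)
    show "linked ?E D u ?q" if "u \<in> D" "{u, ?p} \<in> ?E" "u \<noteq> i" for u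
      using that inv n3 cycle_graph_iff[of n ?p u] by (auto simp: insert_commute)
    show "linked ?E D u ?r" if "u \<in> D" "{u, ?p'} \<in> ?E" "u \<noteq> i" for u
      using that inv n3 cycle_graph_iff[of n ?p' u] by (auto simp: insert_commute)
  qed (use AD iD one p zero q r in auto)
  \<comment> \<open>a third missing vertex \<open>x\<close> would, together with \<open>?p\<close>, separate \<open>?q\<close> from \<open>?r\<close>\<close>
  have "{1..n} - {?p, ?p'} \<subseteq> D"
  proof
    fix x assume x: "x \<in> {1..n} - {?p, ?p'}"
    show "x \<in> D"
    proof (rule ccontr)
      assume xD: "x \<notin> D"
      have "?q \<in> {min ?p x<..<max ?p x} \<longleftrightarrow> ?r \<in> {min ?p x<..<max ?p x}"
        using x p zero xD \<open>linked ?E D ?q ?r\<close> by (intro linked_cycle_cut[OF n3]) auto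
      moreover have "?q \<in> {min ?p x<..<max ?p x} \<longleftrightarrow> ?r \<notin> {min ?p x<..<max ?p x}"
        using x xD q r iD by (intro second_neighbours_separated[OF n_ge i]) auto
      ultimately show False by blast
    qed
  qed
  then have "card ({1..n} - {?p, ?p'}) \<le> card D" using finite_D by (rule card_mono[rotated])
  moreover have "card ({1..n} - {?p, ?p'}) = n - 2"
    using p nxt_prv_distinct[OF n3 i] by (simp add: card_Diff_subset)
  ultimately show False using no by simp
qed

lemma card_D_le: "card D \<le> (\<Sum>i\<in>{1..n}. a i)"
proof -
  have "card D = (\<Sum>i\<in>D. 1)" by simp
  also have "\<dots> \<le> (\<Sum>i\<in>D. a i)" by (intro sum_mono) (simp add: D_def)
  also have "\<dots> \<le> (\<Sum>i\<in>{1..n}. a i)" using D_subset A_subset by (intro sum_mono2) auto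
  finally show ?thesis .
qed

text \<open>Summing over all windows counts each vertex three times.\<close>

lemma degree_bound: "n - 2 \<le> (\<Sum>i\<in>{1..n}. a i) \<or> 2 * n \<le> 3 * (\<Sum>i\<in>{1..n}. a i)"
proof (cases "n - 2 \<le> card D")
  case True
  then show ?thesis using card_D_le by simp
next
  case False
  then have "A = D" using card_D_whole A_eq_D by blast
  then have "(\<Sum>i\<in>{1..n}. 2) \<le> (\<Sum>i\<in>{1..n}. a (prv n i) + a i + a (nxt n i))"
    using window_ge_2 False by (intro sum_mono) blast
  then show ?thesis using sum_window[of n a] n_ge by simp
qed

end

section \<open>A witness of minimal degree\<close>

lemma graded_part_iff:
  "f \<in> graded_part n d \<longleftrightarrow>
     f \<in> carrier (poly_ring n) \<and> (\<forall>m\<in>keys f. (\<Sum>i\<in>{1..n}. mdeg m i) = d)"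
proof -
  have "mon_degree m = (\<Sum>i\<in>{1..n}. mdeg m i)"
    if "f \<in> carrier (poly_ring n)" "m \<in> keys f" for m
    using that by (intro mon_degree_eq_sum_mdeg) (auto simp: carrier_poly_ring)
  then show ?thesis by (auto simp: graded_part_def)
qed

lemma graded_part_mult:
  assumes "f \<in> graded_part n d" "g \<in> graded_part n e"
  shows "f * g \<in> graded_part n (d + e)"
  using assms keys_mult[of f g] mult_carrier[of f n g]
  unfolding graded_part_iff by (fastforce simp: sum.distrib)

lemma graded_part_one: "1 \<in> graded_part n 0"
  by (simp add: graded_part_iff)

lemma graded_part_prod:
  "(\<And>x. x \<in> S \<Longrightarrow> h x \<in> graded_part n d) \<Longrightarrow> (\<Prod>x\<in>S. h x) \<in> graded_part n (d * card S)"
  by (induction S rule: infinite_finite_induct)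
    (simp_all add: graded_part_one graded_part_mult)

lemma graded_part_indet:
  assumes "i \<in> {1..n}"
  shows "indet (X i) \<in> graded_part n 1" "indet (Y i) \<in> graded_part n 1"
  using assms indet_carrier[OF assms] by (auto simp: graded_part_iff indet_def)

lemma graded_part_diff:
  assumes "f \<in> graded_part n d" "g \<in> graded_part n d"
  shows "f - g \<in> graded_part n d"
proof -
  have "m \<in> keys f \<or> m \<in> keys g" if "m \<in> keys (f - g)" for m
    using that by (auto simp: in_keys_iff lookup_minus)
  then show ?thesis using assms diff_carrier[of f n g] unfolding graded_part_iff by blast
qed

lemma graded_part_minor:
  assumes "i \<in> {1..n}" "j \<in> {1..n}"
  shows "minor i j \<in> graded_part n 2"
proof -
  have "indet (X k) * indet (Y l) \<in> graded_part n (1 + 1)" if "k \<in> {1..n}" "l \<in> {1..n}" for k l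
    using that by (intro graded_part_mult graded_part_indet)
  then show ?thesis unfolding minor_def using assms by (intro graded_part_diff) (simp_all add: numeral_2_eq_2)
qed

text \<open>The minor of the two neighbours of \<open>t\<close> survives under the map of
  \<open>B\<close> only if \<open>B\<close> contains these neighbours but does not link them, which
  forces \<open>t \<notin> B\<close>. The variables with index in \<open>W\<close> force \<open>W
  \<subseteq> B\<close>.\<close>

definition separator :: "nat \<Rightarrow> nat set \<Rightarrow> nat set \<Rightarrow> 'k::field poly" where
  "separator n T W = (\<Prod>t\<in>T. minor (prv n t) (nxt n t)) * (\<Prod>w\<in>W. indet (X w))"

lemma separator_graded_part:
  assumes "T \<subseteq> {1..n}" "W \<subseteq> {1..n}"
  shows "separator n T W \<in> graded_part n (2 * card T + card W)"
proof -
  have "(\<Prod>t\<in>T. minor (prv n t) (nxt n t)) \<in> graded_part n (2 * card T)"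
    using assms(1) by (intro graded_part_prod graded_part_minor nxt_prv) blast+
  moreover have "(\<Prod>w\<in>W. indet (X w)) \<in> graded_part n (1 * card W)"
    using assms(2) by (intro graded_part_prod graded_part_indet) blast
  ultimately show ?thesis
    unfolding separator_def using graded_part_mult by fastforce
qed

lemma comp_map_separator_nonzero_iff:
  assumes "finite T" "finite W"
  shows "comp_map E B (separator n T W :: 'k::field poly) \<noteq> 0 \<longleftrightarrow>
    (\<forall>t\<in>T. prv n t \<in> B \<and> nxt n t \<in> B \<and> \<not> linked E B (prv n t) (nxt n t)) \<and> W \<subseteq> B"
proof -
  have "comp_map E B (separator n T W :: 'k poly) = 
      (\<Prod>t\<in>T. comp_map E B (minor (prv n t) (nxt n t))) * (\<Prod>w\<in>W. comp_map E B (indet (X w)))"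
    by (simp add: separator_def comp_map_def slope_mult slope_prod)
  then show ?thesis
    using assms by (auto simp: comp_map_minor_eq_0_iff comp_map_indet_eq_0_iff)
qed

text \<open>When the neighbours of \<open>T\<close> together with \<open>W\<close> cover the
  complement of \<open>T\<close>, the separator determines \<open>B\<close> completely: only one
  component map is nonzero on it.\<close>

lemma isolates_separator:
  assumes n: "n \<ge> 3" and TW: "T \<subseteq> {1..n}" "W \<subseteq> {1..n} - T"
    and nbrs: "\<And>t. t \<in> T \<Longrightarrow> prv n t \<notin> T \<and> nxt n t \<notin> T"
    and sep: "\<And>t. t \<in> T \<Longrightarrow> \<not> linked (cycle_graph n) ({1..n} - T) (prv n t) (nxt n t)"
    and cover: "\<And>i. i \<in> {1..n} \<Longrightarrow> i \<notin> T \<Longrightarrow> i \<in> prv n ` T \<or> i \<in> nxt n ` T \<or> i \<in> W"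
  shows "graph_on.isolates n (cycle_graph n) ({1..n} - T) (separator n T W :: 'k::field poly)"
proof -
  interpret graph_on n "cycle_graph n" using n by (rule graph_on_cycle)
  let ?E = "cycle_graph n"
  have fin: "finite T" "finite W" using TW finite_subset[of _ "{1..n}"] by blast+
  have range: "prv n t \<in> {1..n}" "nxt n t \<in> {1..n}" if "t \<in> T" for t
    using nxt_prv[of t n] TW that by blast+
  have "separator n T W \<in> (carrier (poly_ring n) :: 'k poly set)"
    using separator_graded_part[of T n W] TW by (auto simp: graded_part_def)
  moreover have "comp_map ?E ({1..n} - T) (separator n T W :: 'k poly) \<noteq> 0"
    using range nbrs sep TW(2) by (simp add: comp_map_separator_nonzero_iff fin)
  moreover have "B = {1..n} - T"
    if B: "B \<subseteq> {1..n}" "comp_map ?E B (separator n T W :: 'k poly) \<noteq> 0" for B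
  proof -
    have W: "W \<subseteq> B"
      and T: "\<And>t. t \<in> T \<Longrightarrow> prv n t \<in> B \<and> nxt n t \<in> B \<and> \<not> linked ?E B (prv n t) (nxt n t)"
      using B(2) by (auto simp: comp_map_separator_nonzero_iff fin)
    have "t \<notin> B" if t: "t \<in> T" for t
    proof
      assume "t \<in> B"
      have tn: "t \<in> {1..n}" using t TW by blast
      have "linked ?E B (prv n t) t" "linked ?E B t (nxt n t)"
        using T[OF t] \<open>t \<in> B\<close> tn nxt_prv[OF tn] n by (auto intro!: linked_edge simp: cycle_graph_iff)
      then show False using T[OF t] linked_trans by blast
    qed
    moreover have "{1..n} - T \<subseteq> B" using cover T W by blast
    ultimately show ?thesis using B(1) by blast
  qed
  ultimately show ?thesis unfolding isolates_def by blast
qed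

text \<open>For the upper bound, \<open>T\<close> cuts the cycle into paths with two vertices each,
  the cheapest shape: degree two per three vertices. If \<open>n mod 3 = 2\<close>, one path is a
  single vertex. If \<open>n mod 3 = 1\<close>, the last path has three vertices, and its middle
  vertex \<open>n - 2\<close>, which is no neighbour of \<open>T\<close>, is the element of
  \<open>W\<close>.\<close>

theorem v_number_cycle:
  assumes n: "n \<ge> 6"
  shows "v_number n (binomial_edge_ideal n (cycle_graph n) :: 'k::field poly set) = (2 * n + 2) div 3"
proof -
  define T where "T = insert n ((\<lambda>q. 3 * q) ` {1..(n - 2) div 3})"
  define W where "W = (if n mod 3 = 1 then {n - 2} else {})"
  let ?A = "{1..n} - T"
  have T_iff: "t \<in> T \<longleftrightarrow> t = n \<or> (1 \<le> t \<and> t \<le> n - 2 \<and> t mod 3 = 0)" for t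
  proof -
    have "t \<in> (\<lambda>q. 3 * q) ` {1..(n - 2) div 3} \<longleftrightarrow> 1 \<le> t \<and> t \<le> n - 2 \<and> t mod 3 = 0"
      by (auto simp: image_iff intro!: bexI[of _ "t div 3"])
    then show ?thesis by (simp add: T_def)
  qed
  have Tn: "T \<subseteq> {1..n}" using n by (auto simp: T_iff)
  have Wn: "W \<subseteq> {1..n} - T"
  proof (cases "n mod 3 = 1")
    case True
    then have "(n - 2) mod 3 \<noteq> 0" using n by presburger
    then have "n - 2 \<notin> T" using n by (simp add: T_iff)
    then show ?thesis using n by (auto simp: W_def)
  qed (simp add: W_def)
  have T_cases: "t = n \<and> prv n t = n - 1 \<and> nxt n t = 1 \<or>
      (\<exists>q. 1 \<le> q \<and> 3 * q \<le> n - 2 \<and> t = 3 * q \<and> prv n t = 3 * q - 1 \<and> nxt n t = 3 * q + 1)"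
    if t: "t \<in> T" for t
  proof (cases "t = n")
    case True
    then show ?thesis using n by (simp add: prv_def nxt_def)
  next
    case False
    then have "1 \<le> t" "t \<le> n - 2" "t = 3 * (t div 3)" using t by (auto simp: T_iff)
    then show ?thesis using False by (intro disjI2 exI[of _ "t div 3"]) (auto simp: prv_def nxt_def)
  qed
  have in_A: "i \<in> ?A \<longleftrightarrow> 1 \<le> i \<and> i < n \<and> (i mod 3 = 0 \<longrightarrow> i = n - 1)" for i
    using n by (auto simp: T_iff)
  have step: "(i - 1) div 3 = i div 3" if "i \<in> ?A" "i + 1 \<in> ?A" for i
  proof -
    have "i mod 3 \<noteq> 0" using that unfolding in_A by auto
    then show ?thesis by presburger
  qed
  \<comment> \<open>\<open>(i - 1) div 3\<close> numbers the paths that remain; with \<open>i div 3\<close> a final path of three vertices would be split\<close>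
  have block: "(i - 1) div 3 = (j - 1) div 3" if "linked (cycle_graph n) ?A i j" for i j
    using that
  proof (rule linked_invariant)
    fix u v assume uv: "u \<in> ?A" "v \<in> ?A" "{u, v} \<in> cycle_graph n"
    then have "v = u + 1 \<or> u = v + 1"
      using n cycle_graph_iff[of n u v] unfolding in_A by (auto simp: nxt_def prv_def split: if_splits)
    then show "(u - 1) div 3 = (v - 1) div 3" using uv step[of u] step[of v] by auto
  qed
  have iso: "graph_on.isolates n (cycle_graph n) ?A (separator n T W :: 'k poly)"
  proof (rule isolates_separator)
    fix t assume t: "t \<in> T"
    have apart: "prv n t \<notin> T \<and> nxt n t \<notin> T \<and> (prv n t - 1) div 3 \<noteq> (nxt n t - 1) div 3"
      using T_cases[OF t]
    proof (elim disjE exE conjE)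
      assume "prv n t = n - 1" "nxt n t = 1"
      then show ?thesis using n by (auto simp: T_iff div_eq_0_iff)
    next
      fix q assume q: "1 \<le> q" "3 * q \<le> n - 2" and nb: "prv n t = 3 * q - 1" "nxt n t = 3 * q + 1"
      have "(3 * q - 1) mod 3 \<noteq> 0" "(3 * q + 1) mod 3 \<noteq> 0" "(3 * q - 1 - 1) div 3 < q"
        using q(1) by presburger+
      moreover have "3 * q - 1 \<noteq> n" "3 * q + 1 \<noteq> n" using q n by linarith+
      ultimately show ?thesis by (simp add: T_iff nb)
    qed
    then show "prv n t \<notin> T \<and> nxt n t \<notin> T" by blast
    from apart have "(prv n t - 1) div 3 \<noteq> (nxt n t - 1) div 3" by blast
    then show "\<not> linked (cycle_graph n) ?A (prv n t) (nxt n t)" using block by blast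
  next
    fix i assume i: "i \<in> {1..n}" "i \<notin> T"
    have bound: "1 \<le> i" "i < n" "i mod 3 = 0 \<longrightarrow> i = n - 1" using i in_A[of i] by auto
    have "n \<in> T" by (simp add: T_iff)
    consider "i = 1" | "i = n - 1" | "i \<noteq> 1" "i mod 3 = 1" "i \<noteq> n - 1"
      | "i mod 3 = 2" "i + 1 \<le> n - 2" | "i mod 3 = 2" "i = n - 2"
      using bound by linarith
    then show "i \<in> prv n ` T \<or> i \<in> nxt n ` T \<or> i \<in> W"
    proof cases
      case 1
      then have "i = nxt n n" by (simp add: nxt_def)
      then show ?thesis using \<open>n \<in> T\<close> by blast
    next
      case 2
      then have "i = prv n n" using n by (simp add: prv_def)
      then show ?thesis using \<open>n \<in> T\<close> by blast
    next
      case 3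
      then have "(i - 1) mod 3 = 0" by presburger
      then have "i - 1 \<in> T" "i = nxt n (i - 1)" using 3 bound by (auto simp: T_iff nxt_def)
      then show ?thesis by blast
    next
      case 4
      then have "(i + 1) mod 3 = 0" by presburger
      then have "i + 1 \<in> T" "i = prv n (i + 1)" using 4 bound by (auto simp: T_iff prv_def)
      then show ?thesis by blast
    next
      case 5
      have "n = i + 2" using 5(2) n by linarith
      then have "n mod 3 = 1" using 5(1) by presburger
      then show ?thesis using 5 by (simp add: W_def)
    qed
  qed (use n Tn Wn in auto)
  have deg: "separator n T W \<in> (graded_part n ((2 * n + 2) div 3) :: 'k poly set)"
  proof -
    have "card T = (n - 2) div 3 + 1"
      unfolding T_def by (subst card_insert_disjoint) (auto simp: card_image inj_on_def)
    moreover have "card W = (if n mod 3 = 1 then 1 else 0)" by (simp add: W_def)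
    moreover have "2 * ((n - 2) div 3 + 1) + (if n mod 3 = 1 then 1 else 0) = (2 * n + 2) div 3"
    proof -
      have dm: "n = 3 * (n div 3) + n mod 3" by simp
      have "n mod 3 = 0 \<or> n mod 3 = 1 \<or> n mod 3 = 2" by linarith
      then consider k where "n = 3 * k" | k where "n = 3 * k + 1" | k where "n = 3 * k + 2"
        using dm by (metis add_0_right)
      then show ?thesis
      proof cases
        case (1 k)
        have "(n - 2) div 3 = k - 1" by (rule div_nat_eqI) (use 1 n in auto)
        moreover have "(2 * n + 2) div 3 = 2 * k" by (rule div_nat_eqI) (use 1 n in auto)
        ultimately show ?thesis using 1 n by simp
      next
        case (2 k)
        have "(n - 2) div 3 = k - 1" by (rule div_nat_eqI) (use 2 n in auto)
        moreover have "(2 * n + 2) div 3 = 2 * k + 1" by (rule div_nat_eqI) (use 2 n in auto)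
        ultimately show ?thesis using 2 n by simp
      next
        case (3 k)
        have "(n - 2) div 3 = k" by (rule div_nat_eqI) (use 3 n in auto)
        moreover have "(2 * n + 2) div 3 = 2 * k + 2" by (rule div_nat_eqI) (use 3 n in auto)
        moreover have "n mod 3 = 2" using 3 by presburger
        ultimately show ?thesis by simp
      qed
    qed
    ultimately have "2 * card T + card W = (2 * n + 2) div 3" by simp
    then show ?thesis using separator_graded_part[OF Tn, of W] Wn by auto
  qed
  have low: "(2 * n + 2) div 3 \<le> (\<Sum>i\<in>{1..n}. a i)"
    if "multihom a g" "graph_on.isolates n (cycle_graph n) B g" for a B and g :: "'k poly"
  proof -
    interpret graph_on n "cycle_graph n" using n by (intro graph_on_cycle) simp
    interpret isolating_cycle n B g a using that n by unfold_locales auto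
    show ?thesis using degree_bound n by linarith
  qed
  have "graph_on n (cycle_graph n)" using n by (intro graph_on_cycle) simp
  then show ?thesis using iso deg low by (rule graph_on.v_number_edge_ideal_eqI)
qed

theorem theorem5p8:
  fixes n :: nat
  assumes "n \<ge> 6"
  shows "int (v_number n (binomial_edge_ideal n (cycle_graph n) :: 'k::field poly set))
           = \<lceil>2 * real n / 3\<rceil>"
proof -
  define d where "d = (2 * n + 2) div 3"
  have "2 * n \<le> 3 * d" "3 * d \<le> 2 * n + 2" unfolding d_def by presburger+
  then have "real (2 * n) \<le> real (3 * d)" "real (3 * d) \<le> real (2 * n + 2)"
    by (simp_all only: of_nat_le_iff)
  then have "\<lceil>2 * real n / 3\<rceil> = int d" by (intro ceiling_unique) simp_all
  then show ?thesis by (simp only: v_number_cycle[OF assms] d_def)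
qed

end
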